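(* Restricted to instances $(G,A,b,c)$ with $c=0$, the problem Effectors can be solved in linear time.
   Context: An influence graph $G=(V,E,w)$ is a finite simple directed graph (no loops) with a weight function $w:E\to(0,1]\cap\mathbb{Q}$; $n=|V|$, $m=|E|$, and linear time means $O(n+m)$. Independent Cascade process started from $X\subseteq V$: at time $0$ exactly the nodes in $X$ are active. When a node $u$ becomes active for the first time, at time step $t$, it gets a single chance to activate each currently inactive out-neighbor $v$, succeeding with probability $w(u\to v)$, all attempts being independent; if it succeeds, $v$ becomes active at step $t+1$; if it fails, $u$ makes no further attempts on $v$. Active nodes stay active. The process terminates when there are no newly activated nodes. Let $p(v|X)$ be the probability that $v$ is active upon termination. Cost: for $A\subseteq V$ and $X\subseteq V$, $C_A(G,X):=\sum_{v\in A}(1-p(v|X))+\sum_{v\in V\setminus A}p(v|X)$. Effectors: given an influence graph $G=(V,E,w)$, a set of target nodes $A\subseteq V$, a budget $b\in\mathbb{N}$ and a cost $c\in\mathbb{Q}$, decide whether there is a set $X\subseteq V$ (of effectors) with $|X|\le b$ and $C_A(G,X)\le c$. Running-time convention: operations on the rational numbers in the input take constant time. *)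

theory Defs
  imports
    "HOL-Probability.Probability"
    "HOL-Library.Landau_Symbols"
    "Graph_Theory.Pair_Digraph"
begin

section \<open>Influence graphs and the Independent Cascade process\<close>

locale influence_graph = pair_digraph G
  for G :: "'a pair_pre_digraph" and w :: "'a \<times> 'a \<Rightarrow> rat" +
  assumes weight_pos: "e \<in> parcs G \<Longrightarrow> 0 < w e"
    and weight_le_1: "e \<in> parcs G \<Longrightarrow> w e \<le> 1"

text \<open>
  A state of the process is a pair of the set \<open>S\<close> of active nodes and the set \<open>N\<close> of those
  nodes that became active in the current time step.
\<close>

definition ic_attempts :: "'a pair_pre_digraph \<Rightarrow> 'a set \<Rightarrow> 'a set \<Rightarrow> ('a \<times> 'a) set" where
  "ic_attempts G S N = {(u, v) \<in> parcs G. u \<in> N \<and> v \<notin> S}"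

definition ic_step ::
    "'a pair_pre_digraph \<Rightarrow> ('a \<times> 'a \<Rightarrow> rat) \<Rightarrow> 'a set \<times> 'a set \<Rightarrow> ('a set \<times> 'a set) pmf" where
  "ic_step G w = (\<lambda>(S, N).
     map_pmf (\<lambda>success. let N' = {v. \<exists>u. (u, v) \<in> ic_attempts G S N \<and> success (u, v)} in (S \<union> N', N'))
       (Pi_pmf (ic_attempts G S N) False (\<lambda>e. bernoulli_pmf (of_rat (w e)))))"

primrec ic_state ::
    "'a pair_pre_digraph \<Rightarrow> ('a \<times> 'a \<Rightarrow> rat) \<Rightarrow> 'a set \<Rightarrow> nat \<Rightarrow> ('a set \<times> 'a set) pmf" where
  "ic_state G w X 0 = return_pmf (X, X)"
| "ic_state G w X (Suc t) = bind_pmf (ic_state G w X t) (ic_step G w)"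

text \<open>
  The probability \<open>p(v | X)\<close> that \<open>v\<close> is active upon termination. A state without newly
  activated nodes is never left, and it is reached after at most \<open>card (pverts G)\<close> steps (see
  \<open>ic_terminated\<close> and \<open>activation_prob_eq\<close> below), so the limit is attained.
\<close>

definition activation_prob ::
    "'a pair_pre_digraph \<Rightarrow> ('a \<times> 'a \<Rightarrow> rat) \<Rightarrow> 'a set \<Rightarrow> 'a \<Rightarrow> real" where
  "activation_prob G w X v =
     lim (\<lambda>t. measure_pmf.prob (ic_state G w X t) {(S, N). v \<in> S})"

definition effector_cost ::
    "'a pair_pre_digraph \<Rightarrow> ('a \<times> 'a \<Rightarrow> rat) \<Rightarrow> 'a set \<Rightarrow> 'a set \<Rightarrow> real" where
  "effector_cost G w A X =
     (\<Sum>v\<in>A. 1 - activation_prob G w X v) + (\<Sum>v\<in>pverts G - A. activation_prob G w X v)"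

context influence_graph
begin

lemma ic_state_invariant:
  assumes "X \<subseteq> pverts G" "(S, N) \<in> set_pmf (ic_state G w X t)"
  shows "N \<subseteq> S \<and> S \<subseteq> pverts G \<and> (N = {} \<or> t < card S)"
  using assms(2)
proof (induction t arbitrary: S N)
  case 0
  have "finite X" using assms(1) pair_finite_verts by (rule finite_subset)
  then show ?case using 0 assms(1) by (auto simp: card_gt_0_iff)
next
  case (Suc t)
  then obtain S0 N0 where S0: "(S0, N0) \<in> set_pmf (ic_state G w X t)"
    and st: "(S, N) \<in> set_pmf (ic_step G w (S0, N0))" by auto
  from st obtain f where N: "N = {v. \<exists>u. (u, v) \<in> ic_attempts G S0 N0 \<and> f (u, v)}"
    and S: "S = S0 \<union> N"
    unfolding ic_step_def Let_def by auto
  note IH = Suc.IH[OF S0]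
  have sub: "N \<subseteq> pverts G" "N \<inter> S0 = {}"
    unfolding N ic_attempts_def using in_arcsD2 by blast+
  have fin: "finite S0" "finite N"
    using IH sub(1) finite_subset[OF _ pair_finite_verts] by blast+
  have "Suc t < card S" if "N \<noteq> {}"
  proof -
    have "N0 \<noteq> {}" using that N by (auto simp: ic_attempts_def)
    then have "t < card S0" using IH by simp
    moreover have "card S = card S0 + card N"
      using S fin sub by (simp add: card_Un_disjoint Int_commute)
    moreover have "card N > 0" using that fin by (simp add: card_gt_0_iff)
    ultimately show ?thesis by linarith
  qed
  moreover have "N \<subseteq> S" "S \<subseteq> pverts G" using IH sub S by blast+
  ultimately show ?case by blast
qed

lemma ic_terminated:
  assumes "X \<subseteq> pverts G" "(S, N) \<in> set_pmf (ic_state G w X t)" "card (pverts G) \<le> t"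
  shows "N = {}"
proof -
  have "S \<subseteq> pverts G" using ic_state_invariant[OF assms(1,2)] by simp
  then have "card S \<le> t" using card_mono[OF pair_finite_verts, of S] assms(3) by linarith
  then show ?thesis using ic_state_invariant[OF assms(1,2)] by auto
qed

lemma ic_step_terminated: "ic_step G w (S, {}) = return_pmf (S, {})"
  by (simp add: ic_step_def ic_attempts_def)

lemma ic_state_stationary:
  assumes "X \<subseteq> pverts G"
  shows "ic_state G w X (card (pverts G) + k) = ic_state G w X (card (pverts G))"
proof (induction k)
  case (Suc k)
  have "ic_state G w X (card (pverts G) + Suc k) =
      bind_pmf (ic_state G w X (card (pverts G) + k)) return_pmf"
    using ic_terminated[OF assms, of _ _ "card (pverts G) + k"] ic_step_terminated
    by (auto intro!: bind_pmf_cong)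
  then show ?case using Suc by (simp add: bind_return_pmf')
qed simp

lemma activation_prob_eq:
  assumes "X \<subseteq> pverts G"
  shows "activation_prob G w X v =
    measure_pmf.prob (ic_state G w X (card (pverts G))) {(S, N). v \<in> S}"
  unfolding activation_prob_def
proof (rule limI, rule tendsto_eventually)
  show "\<forall>\<^sub>F t in sequentially. measure_pmf.prob (ic_state G w X t) {(S, N). v \<in> S} =
      measure_pmf.prob (ic_state G w X (card (pverts G))) {(S, N). v \<in> S}"
    unfolding eventually_sequentially
    by (metis assms ic_state_stationary le_Suc_ex)
qed

end


section \<open>The problem Effectors\<close>

record 'a effectors_instance =
  graph :: "'a pair_pre_digraph"
  weight :: "'a \<times> 'a \<Rightarrow> rat"
  targets :: "'a set"
  budget :: nat
  cost :: rat

definition effectors_instance :: "'a effectors_instance \<Rightarrow> bool" where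
  "effectors_instance I \<longleftrightarrow>
     influence_graph (graph I) (weight I) \<and> targets I \<subseteq> pverts (graph I)"

definition effectors :: "'a effectors_instance \<Rightarrow> bool" where
  "effectors I \<longleftrightarrow>
     (\<exists>X \<subseteq> pverts (graph I). card X \<le> budget I \<and>
        effector_cost (graph I) (weight I) (targets I) X \<le> of_rat (cost I))"


section \<open>A machine model for linear time\<close>

text \<open>
  Programs of a random access machine, in structured form, with finitely many zero-initialised
  arrays of natural numbers. Natural number arithmetic is restricted to successor, predecessor
  and comparison. In this way no cell ever exceeds the largest number in the input and in the
  program by more than a constant times the number of steps, and charging one unit for operations
  on cells is no abuse.

  Rational numbers occur only as read-only input. Expressions over them (and comparisons of such
  expressions) are evaluated at unit cost, but the results cannot be stored, so the rational
  operations are performed only on input numbers, to a depth fixed by the program.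
\<close>

type_synonym nat_memory = "string \<Rightarrow> nat \<Rightarrow> nat"
type_synonym rat_memory = "string \<Rightarrow> nat \<Rightarrow> rat"

datatype nexp =
    Const nat
  | Cell string nexp
  | Succ nexp
  | Pred nexp

datatype qexp =
    QConst rat
  | QCell string nexp
  | QAdd qexp qexp
  | QSub qexp qexp
  | QMul qexp qexp
  | QDiv qexp qexp

datatype test =
    Less nexp nexp
  | QLess qexp qexp
  | Not test
  | And test test

datatype com =
    Skip
  | Assign string nexp nexp
  | Seq com com
  | If test com com
  | While test com

primrec nval :: "nat_memory \<Rightarrow> nexp \<Rightarrow> nat" where
  "nval s (Const k) = k"
| "nval s (Cell x a) = s x (nval s a)"
| "nval s (Succ a) = nval s a + 1"
| "nval s (Pred a) = nval s a - 1"

primrec qval :: "rat_memory \<Rightarrow> nat_memory \<Rightarrow> qexp \<Rightarrow> rat" where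
  "qval q s (QConst r) = r"
| "qval q s (QCell x a) = q x (nval s a)"
| "qval q s (QAdd a b) = qval q s a + qval q s b"
| "qval q s (QSub a b) = qval q s a - qval q s b"
| "qval q s (QMul a b) = qval q s a * qval q s b"
| "qval q s (QDiv a b) = qval q s a / qval q s b"

primrec tval :: "rat_memory \<Rightarrow> nat_memory \<Rightarrow> test \<Rightarrow> bool" where
  "tval q s (Less a b) \<longleftrightarrow> nval s a < nval s b"
| "tval q s (QLess a b) \<longleftrightarrow> qval q s a < qval q s b"
| "tval q s (Not b) \<longleftrightarrow> \<not> tval q s b"
| "tval q s (And a b) \<longleftrightarrow> tval q s a \<and> tval q s b"

text \<open>
  \<open>exec q P s t s'\<close>: with rational input \<open>q\<close> and initial memory \<open>s\<close>, the program \<open>P\<close>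
  terminates after \<open>t\<close> steps in memory \<open>s'\<close>. \<open>Assign x a e\<close> stores the value of \<open>e\<close> in cell
  \<open>a\<close> of array \<open>x\<close>. The expressions in a program have bounded size, so counting every command
  and every evaluation of a test as one step changes running times by a constant factor only.
\<close>

inductive exec :: "rat_memory \<Rightarrow> com \<Rightarrow> nat_memory \<Rightarrow> nat \<Rightarrow> nat_memory \<Rightarrow> bool" for q where
  exec_Skip: "exec q Skip s 1 s"
| exec_Assign: "exec q (Assign x a e) s 1 (s(x := (s x)(nval s a := nval s e)))"
| exec_Seq: "exec q P s t s' \<Longrightarrow> exec q Q s' t' s'' \<Longrightarrow> exec q (Seq P Q) s (t + t') s''"
| exec_If_True: "tval q s b \<Longrightarrow> exec q P s t s' \<Longrightarrow> exec q (If b P Q) s (1 + t) s'"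
| exec_If_False: "\<not> tval q s b \<Longrightarrow> exec q Q s t s' \<Longrightarrow> exec q (If b P Q) s (1 + t) s'"
| exec_While_False: "\<not> tval q s b \<Longrightarrow> exec q (While b P) s 1 s"
| exec_While_True: "tval q s b \<Longrightarrow> exec q P s t s' \<Longrightarrow> exec q (While b P) s' t' s'' \<Longrightarrow>
    exec q (While b P) s (1 + t + t') s''"

lemma exec_deterministic:
  assumes "exec q P s t s'" "exec q P s u s''"
  shows "t = u \<and> s' = s''"
  using assms
proof (induction arbitrary: u s'')
  case (exec_Skip s)
  then show ?case by (cases rule: exec.cases) auto
next
  case (exec_Assign x a e s)
  then show ?case by (cases rule: exec.cases) auto
next
  case (exec_Seq P s t s' Q t' s'')
  from exec_Seq.prems show ?case
    by (cases rule: exec.cases) (use exec_Seq.IH in blast)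
next
  case (exec_If_True s b P t s' Q)
  from exec_If_True.prems show ?case
    by (cases rule: exec.cases) (use exec_If_True.hyps exec_If_True.IH in blast)+
next
  case (exec_If_False s b Q t s' P)
  from exec_If_False.prems show ?case
    by (cases rule: exec.cases) (use exec_If_False.hyps exec_If_False.IH in blast)+
next
  case (exec_While_False s b P)
  from exec_While_False.prems show ?case
    by (cases rule: exec.cases) (use exec_While_False.hyps in blast)+
next
  case (exec_While_True s b P t s' t' s'')
  from exec_While_True.prems show ?case
    by (cases rule: exec.cases) (use exec_While_True.hyps exec_While_True.IH in blast)+
qed

text \<open>
  Instances are given to the machine by adjacency lists. The list \<open>vs\<close> enumerates the nodes, and
  \<open>adj ! i\<close> lists, in any order, the arcs leaving \<open>vs ! i\<close>, each as the number of its head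
  together with its weight.
\<close>

definition adjacency_lists ::
    "'a effectors_instance \<Rightarrow> 'a list \<Rightarrow> (nat \<times> rat) list list \<Rightarrow> bool" where
  "adjacency_lists I vs adj \<longleftrightarrow>
     distinct vs \<and> set vs = pverts (graph I) \<and> length adj = length vs \<and>
     (\<forall>i < length vs. distinct (adj ! i) \<and>
        set (adj ! i) = {(j, weight I (vs ! i, vs ! j)) | j.
                           j < length vs \<and> (vs ! i, vs ! j) \<in> parcs (graph I)})"

definition cells :: "'b::zero list \<Rightarrow> nat \<Rightarrow> 'b" where
  "cells xs i = (if i < length xs then xs ! i else 0)"

text \<open>
  The adjacency lists are stored one after the other: the arcs leaving node number \<open>i\<close> are those
  with numbers from \<open>first_arc i\<close> up to, but excluding, \<open>first_arc (i + 1)\<close>.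
\<close>

definition nat_input ::
    "'a effectors_instance \<Rightarrow> 'a list \<Rightarrow> (nat \<times> rat) list list \<Rightarrow> nat_memory" where
  "nat_input I vs adj = (\<lambda>_ _. 0)(
     ''nodes'' := cells [length vs],
     ''arcs'' := cells [length (concat adj)],
     ''first_arc'' := cells (map (\<lambda>i. length (concat (take i adj))) [0..<length vs + 1]),
     ''head'' := cells (map fst (concat adj)),
     ''target'' := cells (map (\<lambda>v. if v \<in> targets I then 1 else 0) vs),
     ''budget'' := cells [budget I])"

definition rat_input ::
    "'a effectors_instance \<Rightarrow> (nat \<times> rat) list list \<Rightarrow> rat_memory" where
  "rat_input I adj = (\<lambda>_ _. 0)(
     ''weight'' := cells (map snd (concat adj)),
     ''cost'' := cells [cost I])"

definition graph_size :: "'a effectors_instance \<Rightarrow> nat" where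
  "graph_size I = card (pverts (graph I)) + card (parcs (graph I))"

text \<open>
  \<open>solvable_in_linear_time R Q\<close>: a single program decides \<open>Q\<close>, in time linear in the number of
  nodes and arcs, on all instances from \<open>R\<close>, however their nodes are numbered and their
  adjacency lists are ordered.
\<close>

definition solvable_in_linear_time ::
    "'a effectors_instance set \<Rightarrow> ('a effectors_instance \<Rightarrow> bool) \<Rightarrow> bool" where
  "solvable_in_linear_time R Q \<longleftrightarrow>
     (\<exists>P T. (\<lambda>k. real (T k)) \<in> O(\<lambda>k. real k) \<and>
        (\<forall>I \<in> R. \<forall>vs adj. adjacency_lists I vs adj \<longrightarrow>
           (\<exists>t s. exec (rat_input I adj) P (nat_input I vs adj) t s \<and>
              t \<le> T (graph_size I) \<and>
              s ''result'' 0 = (if Q I then 1 else 0))))"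

end

theory Submission
  imports Defs
begin

text \<open>
  For cost 0 every target must be active with probability 1 and every other node with
  probability 0. A node is active with probability 1 iff it is reachable from \<open>X\<close> along arcs of
  weight 1 (possibly all other attempts fail), and with probability 0 iff it is not reachable at
  all (possibly all attempts succeed). Hence the target set \<open>A\<close> must be closed under arcs, and \<open>X\<close>
  must be a subset of \<open>A\<close> from which all of \<open>A\<close> is reachable along arcs of weight 1.

  The least size of such an \<open>X\<close> can be found without computing strong components. Go through the
  nodes of \<open>A\<close>, take every node not yet reached as a root and mark everything reachable from it:
  no root is reachable from an earlier one. Repeating this with the roots only, in reverse order,
  yields roots none of which is reachable from another, and such an antichain \<open>K\<close> is optimal: if
  \<open>x \<in> X\<close> reaches \<open>k \<in> K\<close> and \<open>k' \<in> K\<close> reaches \<open>x\<close>, then \<open>k' = k\<close>, so \<open>x\<close> and \<open>k\<close> reach each other,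
  and this assigns different \<open>x\<close> to different \<open>k\<close>.
\<close>

section \<open>Instances of cost zero\<close>

text \<open>Weights are at most 1, so this means weight exactly 1; the inequality is the negation of
  the strict comparison that the machine can perform.\<close>

definition sure_arcs :: "'a pair_pre_digraph \<Rightarrow> ('a \<times> 'a \<Rightarrow> rat) \<Rightarrow> ('a \<times> 'a) set" where
  "sure_arcs G w = {e \<in> parcs G. 1 \<le> w e}"

section \<open>Possible outcomes of the cascade\<close>

context influence_graph
begin

lemma set_pmf_arc: "e \<in> parcs G \<Longrightarrow>
    set_pmf (bernoulli_pmf (of_rat (w e))) = (if 1 \<le> w e then {True} else UNIV)"
proof -
  assume e: "e \<in> parcs G"
  show ?thesis
  proof (cases "1 \<le> w e")
    case True
    then have "w e = 1" using weight_le_1[OF e] by simp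
    moreover have "x \<in> set_pmf (bernoulli_pmf 1) \<longleftrightarrow> x" for x
      by (cases x) (simp_all add: set_pmf_iff)
    ultimately show ?thesis using True by auto
  next
    case False
    then show ?thesis using weight_pos[OF e] by (simp add: of_rat_less_1_iff)
  qed
qed

lemma finite_ic_attempts: "finite (ic_attempts G S N)"
  by (rule finite_subset[OF _ pair_finite_arcs]) (auto simp: ic_attempts_def)

text \<open>Attempts are independent, so the support of a step is a product: any set
  \<open>F\<close> of successes can occur that includes the attempts certain to succeed. Arguments
  about possible runs thereby become purely set-theoretic.\<close>

lemma ic_step_support:
  "(S', N') \<in> set_pmf (ic_step G w (S, N)) \<longleftrightarrow>
    (\<exists>F. ic_attempts G S N \<inter> sure_arcs G w \<subseteq> F \<and> F \<subseteq> ic_attempts G S N \<and>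
      N' = snd ` F \<and> S' = S \<union> N')" (is "?l \<longleftrightarrow> ?r")
proof
  let ?B = "ic_attempts G S N"
  assume ?l
  then have "(S', N') \<in> (\<lambda>f. let N' = {v. \<exists>u. (u, v) \<in> ?B \<and> f (u, v)} in (S \<union> N', N')) `
      PiE_dflt ?B False (set_pmf \<circ> (\<lambda>e. bernoulli_pmf (of_rat (w e))))"
    by (simp only: ic_step_def prod.case set_map_pmf set_Pi_pmf[OF finite_ic_attempts])
  then obtain f where f: "f \<in> PiE_dflt ?B False (set_pmf \<circ> (\<lambda>e. bernoulli_pmf (of_rat (w e))))"
    and "(S', N') = (let N' = {v. \<exists>u. (u, v) \<in> ?B \<and> f (u, v)} in (S \<union> N', N'))"
    by (rule imageE)
  then have N: "N' = {v. \<exists>u. (u, v) \<in> ?B \<and> f (u, v)}" and S: "S' = S \<union> N'"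
    by (simp_all add: Let_def)
  have "f e" if "e \<in> ?B" "e \<in> sure_arcs G w" for e
  proof -
    have "f e \<in> set_pmf (bernoulli_pmf (of_rat (w e)))"
      using f that(1) unfolding PiE_dflt_def mem_Collect_eq comp_def by blast
    then show ?thesis using that(2) set_pmf_arc[of e] by (simp add: sure_arcs_def)
  qed
  then have "?B \<inter> sure_arcs G w \<subseteq> {e \<in> ?B. f e}" by auto
  moreover have "N' = snd ` {e \<in> ?B. f e}" unfolding N by force
  ultimately show ?r using S by blast
next
  let ?B = "ic_attempts G S N"
  assume ?r
  then obtain F where F: "?B \<inter> sure_arcs G w \<subseteq> F" "F \<subseteq> ?B" "N' = snd ` F" "S' = S \<union> N'"
    by blast
  \<comment> \<open>The indicator of \<open>F\<close> is \<open>False\<close> outside the attempts,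
    which is the default value in \<open>Pi_pmf\<close>.\<close>
  have "(\<lambda>e. e \<in> F) \<in> PiE_dflt ?B False (set_pmf \<circ> (\<lambda>e. bernoulli_pmf (of_rat (w e))))"
    unfolding PiE_dflt_def
  proof (intro CollectI allI conjI impI)
    fix e assume e: "e \<in> ?B"
    then have "e \<in> parcs G" by (auto simp: ic_attempts_def)
    then show "(e \<in> F) \<in> (set_pmf \<circ> (\<lambda>e. bernoulli_pmf (of_rat (w e)))) e"
      using F(1) e set_pmf_arc[of e] by (auto simp: sure_arcs_def)
  next
    fix e assume "e \<notin> ?B"
    then show "(e \<in> F) = False" using F(2) by blast
  qed
  moreover have "N' = {v. \<exists>u. (u, v) \<in> ?B \<and> (u, v) \<in> F}"
    using F(2,3) by (force simp: image_iff)
  ultimately show ?l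
    using F(4)
    by (simp only: ic_step_def prod.case set_map_pmf set_Pi_pmf[OF finite_ic_attempts])
      (rule image_eqI[of _ _ "\<lambda>e. e \<in> F"]; simp add: Let_def)
qed

lemma ic_state_superset: "(S, N) \<in> set_pmf (ic_state G w X t) \<Longrightarrow> X \<subseteq> S"
proof (induction t arbitrary: S N)
  case (Suc t)
  then obtain S0 N0 where SN: "(S0, N0) \<in> set_pmf (ic_state G w X t)"
    "(S, N) \<in> set_pmf (ic_step G w (S0, N0))" by auto
  from SN(2) have "S0 \<subseteq> S" unfolding ic_step_support by blast
  then show ?case using Suc.IH[OF SN(1)] by blast
qed simp

lemma ic_state_closed_subset:
  assumes "parcs G `` A \<subseteq> A" "X \<subseteq> A"
  shows "(S, N) \<in> set_pmf (ic_state G w X t) \<Longrightarrow> S \<subseteq> A \<and> N \<subseteq> A"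
proof (induction t arbitrary: S N)
  case (Suc t)
  then obtain S0 N0 where SN: "(S0, N0) \<in> set_pmf (ic_state G w X t)"
    "(S, N) \<in> set_pmf (ic_step G w (S0, N0))" by auto
  from SN(2) obtain F where F: "F \<subseteq> ic_attempts G S0 N0" "N = snd ` F" "S = S0 \<union> N"
    unfolding ic_step_support by blast
  have "N \<subseteq> parcs G `` N0" using F(1,2) by (force simp: ic_attempts_def)
  then show ?case using F(3) Suc.IH[OF SN(1)] assms(1) by blast
qed (use assms in simp)

text \<open>Nodes in \<open>N\<close> still have their attempts ahead of them, so closedness can be
  claimed only for \<open>S - N\<close>; at termination \<open>N\<close> is empty and
  \<open>S\<close> itself is closed.\<close>

lemma ic_state_sure:
  "(S, N) \<in> set_pmf (ic_state G w X t) \<Longrightarrow> N \<subseteq> S \<and> sure_arcs G w `` (S - N) \<subseteq> S"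
proof (induction t arbitrary: S N)
  case (Suc t)
  then obtain S0 N0 where SN: "(S0, N0) \<in> set_pmf (ic_state G w X t)"
    "(S, N) \<in> set_pmf (ic_step G w (S0, N0))" by auto
  note IH = Suc.IH[OF SN(1)]
  from SN(2) obtain F where F: "ic_attempts G S0 N0 \<inter> sure_arcs G w \<subseteq> F" "F \<subseteq> ic_attempts G S0 N0"
      "N = snd ` F" "S = S0 \<union> N"
    unfolding ic_step_support by blast
  have "v \<in> S" if "u \<in> S - N" "(u, v) \<in> sure_arcs G w" for u v
  proof (cases "u \<in> N0 \<and> v \<notin> S0")
    case True
    then have "(u, v) \<in> F" using F(1) that by (auto simp: ic_attempts_def sure_arcs_def)
    then show ?thesis using F(3,4) by force
  next
    case False
    then show ?thesis using IH F(4) that by blast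
  qed
  then show ?case using F(4) by blast
qed simp

text \<open>Positive weights allow the run in which every attempt succeeds. Its final state contains
  everything reachable from \<open>X\<close>.\<close>

lemma ic_state_all_succeed:
  "\<exists>S N. (S, N) \<in> set_pmf (ic_state G w X t) \<and> N \<subseteq> S \<and> parcs G `` (S - N) \<subseteq> S"
proof (induction t)
  case (Suc t)
  then obtain S N where SN: "(S, N) \<in> set_pmf (ic_state G w X t)" "N \<subseteq> S"
    "parcs G `` (S - N) \<subseteq> S" by blast
  let ?N = "snd ` ic_attempts G S N"
  have "(S \<union> ?N, ?N) \<in> set_pmf (ic_step G w (S, N))" by (auto simp: ic_step_support)
  then have "(S \<union> ?N, ?N) \<in> set_pmf (ic_state G w X (Suc t))" using SN(1) by auto
  moreover have "v \<in> S \<union> ?N" if "u \<in> S \<union> ?N - ?N" "(u, v) \<in> parcs G" for u v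
  proof (cases "u \<in> N \<and> v \<notin> S")
    case True
    then have "(u, v) \<in> ic_attempts G S N" using that by (auto simp: ic_attempts_def)
    then show ?thesis by force
  next
    case False
    then show ?thesis using SN that by blast
  qed
  ultimately show ?case by blast
qed auto

text \<open>The run in which only the attempts along sure arcs succeed is possible; it witnesses
  that nodes beyond their reach can stay inactive.\<close>

lemma ic_state_only_sure_succeed:
  "\<exists>S N. (S, N) \<in> set_pmf (ic_state G w X t) \<and> S \<subseteq> (sure_arcs G w)\<^sup>* `` X \<and> N \<subseteq> S"
proof (induction t)
  case (Suc t)
  then obtain S N where SN: "(S, N) \<in> set_pmf (ic_state G w X t)" "N \<subseteq> S"
    "S \<subseteq> (sure_arcs G w)\<^sup>* `` X" by blast
  let ?N = "snd ` (ic_attempts G S N \<inter> sure_arcs G w)"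
  have "(S \<union> ?N, ?N) \<in> set_pmf (ic_step G w (S, N))" by (auto simp: ic_step_support)
  then have "(S \<union> ?N, ?N) \<in> set_pmf (ic_state G w X (Suc t))" using SN(1) by auto
  moreover have "v \<in> (sure_arcs G w)\<^sup>* `` X"
    if "(u, v) \<in> ic_attempts G S N" "(u, v) \<in> sure_arcs G w" for u v
  proof -
    have "u \<in> (sure_arcs G w)\<^sup>* `` X" using that(1) SN(2,3) by (auto simp: ic_attempts_def)
    then show ?thesis using that(2) by (blast intro: rtrancl.rtrancl_into_rtrancl)
  qed
  ultimately show ?case using SN(3) by (intro exI[of _ "S \<union> ?N"] exI[of _ ?N]) auto
qed auto

section \<open>Activation with probability one or zero\<close>

lemma activation_prob_bounds:
  assumes "X \<subseteq> pverts G"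
  shows "0 \<le> activation_prob G w X v" "activation_prob G w X v \<le> 1"
  by (simp_all add: activation_prob_eq[OF assms])

text \<open>At time \<open>card (pverts G)\<close> the process has ended, and probability 1 means
  membership in every possible final state. Each such state is closed under sure arcs, and one of
  them is confined to what these reach from \<open>X\<close>.\<close>

lemma activation_prob_eq_1_iff:
  assumes "X \<subseteq> pverts G"
  shows "activation_prob G w X v = 1 \<longleftrightarrow> v \<in> (sure_arcs G w)\<^sup>* `` X"
proof -
  let ?p = "ic_state G w X (card (pverts G))"
  have "activation_prob G w X v = 1 \<longleftrightarrow> (\<forall>S N. (S, N) \<in> set_pmf ?p \<longrightarrow> v \<in> S)"
    by (auto simp: activation_prob_eq[OF assms] measure_pmf.prob_eq_1 AE_measure_pmf_iff)
  also have "\<dots> \<longleftrightarrow> v \<in> (sure_arcs G w)\<^sup>* `` X"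
  proof
    assume "\<forall>S N. (S, N) \<in> set_pmf ?p \<longrightarrow> v \<in> S"
    then show "v \<in> (sure_arcs G w)\<^sup>* `` X"
      using ic_state_only_sure_succeed[of X "card (pverts G)"] by blast
  next
    assume v: "v \<in> (sure_arcs G w)\<^sup>* `` X"
    show "\<forall>S N. (S, N) \<in> set_pmf ?p \<longrightarrow> v \<in> S"
    proof (intro allI impI)
      fix S N assume SN: "(S, N) \<in> set_pmf ?p"
      have "N = {}" using ic_terminated[OF assms SN] by simp
      then have "sure_arcs G w `` S \<subseteq> S" using ic_state_sure[OF SN] by simp
      then have "(sure_arcs G w)\<^sup>* `` S = S" by (rule Image_closed_trancl)
      then show "v \<in> S" using v ic_state_superset[OF SN] by blast
    qed
  qed
  finally show ?thesis .
qed

text \<open>Dually, some possible final state is closed under all arcs, while no run leaves the set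
  reachable from \<open>X\<close>.\<close>

lemma activation_prob_eq_0_iff:
  assumes "X \<subseteq> pverts G"
  shows "activation_prob G w X v = 0 \<longleftrightarrow> v \<notin> (parcs G)\<^sup>* `` X"
proof -
  let ?p = "ic_state G w X (card (pverts G))"
  have "activation_prob G w X v = 0 \<longleftrightarrow> (\<forall>S N. (S, N) \<in> set_pmf ?p \<longrightarrow> v \<notin> S)"
    by (auto simp: activation_prob_eq[OF assms] measure_pmf.prob_eq_0 AE_measure_pmf_iff)
  also have "\<dots> \<longleftrightarrow> v \<notin> (parcs G)\<^sup>* `` X"
  proof
    assume v: "\<forall>S N. (S, N) \<in> set_pmf ?p \<longrightarrow> v \<notin> S"
    obtain S N where SN: "(S, N) \<in> set_pmf ?p" "parcs G `` (S - N) \<subseteq> S"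
      using ic_state_all_succeed by blast
    have "N = {}" using ic_terminated[OF assms SN(1)] by simp
    then have "(parcs G)\<^sup>* `` S = S" using SN(2) by (intro Image_closed_trancl) simp
    then show "v \<notin> (parcs G)\<^sup>* `` X" using v SN(1) ic_state_superset[OF SN(1)] by blast
  next
    assume v: "v \<notin> (parcs G)\<^sup>* `` X"
    have "parcs G `` ((parcs G)\<^sup>* `` X) \<subseteq> (parcs G)\<^sup>* `` X" by (auto intro: rtrancl.rtrancl_into_rtrancl)
    from ic_state_closed_subset[OF this] v
    show "\<forall>S N. (S, N) \<in> set_pmf ?p \<longrightarrow> v \<notin> S" by blast
  qed
  finally show ?thesis .
qed

text \<open>Both sums have nonnegative terms, so a cost of at most 0 forces every term to
  vanish.\<close>

lemma effector_cost_le_0_iff: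
  assumes X: "X \<subseteq> pverts G" and A: "A \<subseteq> pverts G"
  shows "effector_cost G w A X \<le> 0 \<longleftrightarrow>
    A \<subseteq> (sure_arcs G w)\<^sup>* `` X \<and> (parcs G)\<^sup>* `` X \<subseteq> A"
proof -
  have fin: "finite A" "finite (pverts G - A)"
    using finite_subset[OF A pair_finite_verts] pair_finite_verts by auto
  note bounds = activation_prob_bounds[OF X]
  have nonneg: "0 \<le> (\<Sum>v\<in>A. 1 - activation_prob G w X v)"
    "0 \<le> (\<Sum>v\<in>pverts G - A. activation_prob G w X v)"
    using bounds by (auto intro: sum_nonneg)
  have "effector_cost G w A X \<le> 0 \<longleftrightarrow> (\<Sum>v\<in>A. 1 - activation_prob G w X v) = 0 \<and>
      (\<Sum>v\<in>pverts G - A. activation_prob G w X v) = 0"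
    unfolding effector_cost_def using nonneg by linarith
  also have "\<dots> \<longleftrightarrow> (\<forall>v\<in>A. activation_prob G w X v = 1) \<and>
      (\<forall>v\<in>pverts G - A. activation_prob G w X v = 0)"
    using fin bounds by (simp add: sum_nonneg_eq_0_iff eq_commute[of 1])
  also have "\<dots> \<longleftrightarrow> A \<subseteq> (sure_arcs G w)\<^sup>* `` X \<and> (parcs G)\<^sup>* `` X \<inter> pverts G \<subseteq> A"
    unfolding activation_prob_eq_1_iff[OF X] activation_prob_eq_0_iff[OF X] by blast
  \<comment> \<open>The cost speaks only about nodes of the graph; since all arcs end there, the
    intersection loses nothing reachable from \<open>X\<close>.\<close>
  also have "(parcs G)\<^sup>* `` X \<inter> pverts G = (parcs G)\<^sup>* `` X"
  proof -
    have "(parcs G)\<^sup>* `` pverts G = pverts G"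
      using in_arcsD2 by (intro Image_closed_trancl) blast
    then show ?thesis using X by blast
  qed
  finally show ?thesis .
qed

end

section \<open>Antichains and covers with respect to reachability\<close>

lemma antichain_cover_minimal:
  assumes K: "sorted_wrt (\<lambda>a b. (a, b) \<notin> D\<^sup>*) K" "sorted_wrt (\<lambda>a b. (b, a) \<notin> D\<^sup>*) K"
    and cover: "X \<subseteq> D\<^sup>* `` set K" "set K \<subseteq> D\<^sup>* `` X" and fin: "finite X"
  shows "length K \<le> card X"
proof -
  \<comment> \<open>One order condition excludes paths forward in the list, the other paths
    backward. As reachability is reflexive, repeated entries are excluded as well.\<close>
  have antichain: "i = j" if "i < length K" "j < length K" "(K ! i, K ! j) \<in> D\<^sup>*" for i j
    using K that by (metis nat_neq_iff sorted_wrt_iff_nth_less)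
  have "\<forall>i<length K. \<exists>x\<in>X. (x, K ! i) \<in> D\<^sup>* \<and> (K ! i, x) \<in> D\<^sup>*"
  proof (intro allI impI)
    fix i assume i: "i < length K"
    then obtain x where x: "x \<in> X" "(x, K ! i) \<in> D\<^sup>*" using cover(2) nth_mem by blast
    then obtain j where j: "j < length K" "(K ! j, x) \<in> D\<^sup>*"
      using cover(1) by (metis ImageE in_mono in_set_conv_nth)
    \<comment> \<open>\<open>K ! j\<close> reaches \<open>K ! i\<close> through
      \<open>x\<close>.\<close>
    then have "j = i" using antichain i x(2) by (meson rtrancl_trans)
    then show "\<exists>x\<in>X. (x, K ! i) \<in> D\<^sup>* \<and> (K ! i, x) \<in> D\<^sup>*" using x j by blast
  qed
  then obtain f where f: "\<And>i. i < length K \<Longrightarrow>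
      f i \<in> X \<and> (f i, K ! i) \<in> D\<^sup>* \<and> (K ! i, f i) \<in> D\<^sup>*"
    by metis
  \<comment> \<open>A common value would give a path from \<open>K ! i\<close> to
    \<open>K ! j\<close>.\<close>
  have "inj_on f {..<length K}"
  proof (rule inj_onI)
    fix i j assume "i \<in> {..<length K}" "j \<in> {..<length K}" "f i = f j"
    then show "i = j" using f[of i] f[of j] antichain by (metis lessThan_iff rtrancl_trans)
  qed
  moreover have "f ` {..<length K} \<subseteq> X" using f by auto
  ultimately have "card {..<length K} \<le> card X" using fin card_inj_on_le by blast
  then show ?thesis by simp
qed

text \<open>A zero-cost \<open>X\<close> lies within the targets and reaches all of them by sure
  arcs, so the antichain bound applies to it. Conversely, the entries of \<open>K\<close> serve as
  effectors once the targets are closed.\<close>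

lemma effectors_cost_0_iff:
  assumes I: "effectors_instance I" "cost I = 0"
    and K: "sorted_wrt (\<lambda>a b. (a, b) \<notin> (sure_arcs (graph I) (weight I))\<^sup>*) K"
      "sorted_wrt (\<lambda>a b. (b, a) \<notin> (sure_arcs (graph I) (weight I))\<^sup>*) K"
      "set K \<subseteq> targets I" "targets I \<subseteq> (sure_arcs (graph I) (weight I))\<^sup>* `` set K"
  shows "effectors I \<longleftrightarrow>
    parcs (graph I) `` targets I \<subseteq> targets I \<and> length K \<le> budget I"
proof -
  interpret influence_graph "graph I" "weight I"
    using I(1) by (simp add: effectors_instance_def)
  let ?D = "sure_arcs (graph I) (weight I)" and ?E = "parcs (graph I)"
  have A: "targets I \<subseteq> pverts (graph I)" using I(1) by (simp add: effectors_instance_def)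
  have DE: "?D \<subseteq> ?E" by (auto simp: sure_arcs_def)
  have *: "effectors I \<longleftrightarrow> (\<exists>X \<subseteq> pverts (graph I). card X \<le> budget I \<and>
      targets I \<subseteq> ?D\<^sup>* `` X \<and> ?E\<^sup>* `` X \<subseteq> targets I)"
    unfolding effectors_def I(2) of_rat_0
    by (intro ex_cong1 conj_cong refl effector_cost_le_0_iff[OF _ A])
  show ?thesis
  proof
    assume "effectors I"
    then obtain X where X: "X \<subseteq> pverts (graph I)" "card X \<le> budget I"
      "targets I \<subseteq> ?D\<^sup>* `` X" "?E\<^sup>* `` X \<subseteq> targets I" unfolding * by blast
    have "targets I \<subseteq> ?E\<^sup>* `` X" using X(3) rtrancl_mono[OF DE] by blast
    \<comment> \<open>Sure arcs are arcs, so the targets are exactly the set reachable from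
      \<open>X\<close>, which is closed.\<close>
    then have closed: "?E `` targets I \<subseteq> targets I"
      using X(4) by (blast intro: rtrancl.rtrancl_into_rtrancl)
    have "X \<subseteq> targets I" using X(4) by blast
    then have "length K \<le> card X"
      using K X(1,3) finite_subset[OF _ pair_finite_verts]
      by (intro antichain_cover_minimal[of ?D]) auto
    then show "?E `` targets I \<subseteq> targets I \<and> length K \<le> budget I" using X(2) closed by simp
  next
    assume r: "?E `` targets I \<subseteq> targets I \<and> length K \<le> budget I"
    then have "?E\<^sup>* `` targets I = targets I" by (intro Image_closed_trancl) simp
    then have "?E\<^sup>* `` set K \<subseteq> targets I" using K(3) by blast
    moreover have "card (set K) \<le> budget I" using r card_length[of K] by linarith
    ultimately show "effectors I" unfolding * using K(3,4) A by blast
  qed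
qed

section \<open>Weakest preconditions with running time\<close>

text \<open>Total correctness in existential form, with the running time passed to the
  postcondition; \<open>solvable_in_linear_time\<close> asks for runs in this form.\<close>

definition wp :: "rat_memory \<Rightarrow> com \<Rightarrow> nat_memory \<Rightarrow> (nat \<Rightarrow> nat_memory \<Rightarrow> bool) \<Rightarrow> bool" where
  "wp q P s Q \<longleftrightarrow> (\<exists>t s'. exec q P s t s' \<and> Q t s')"

lemma wp_Skip [simp]: "wp q Skip s Q \<longleftrightarrow> Q 1 s"
  unfolding wp_def by (subst exec.simps) simp

lemma wp_Assign [simp]:
  "wp q (Assign x a e) s Q \<longleftrightarrow> Q 1 (s(x := (s x)(nval s a := nval s e)))"
  unfolding wp_def by (subst exec.simps) simp

lemma wp_Seq [simp]:
  "wp q (Seq P1 P2) s Q \<longleftrightarrow> wp q P1 s (\<lambda>t s'. wp q P2 s' (\<lambda>t' s''. Q (t + t') s''))"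
  unfolding wp_def by (subst exec.simps) (simp, blast)

lemma wp_If [simp]:
  "wp q (If b P1 P2) s Q \<longleftrightarrow>
    (if tval q s b then wp q P1 s (\<lambda>t. Q (1 + t)) else wp q P2 s (\<lambda>t. Q (1 + t)))"
  unfolding wp_def by (subst exec.simps) auto

lemma wp_mono: "wp q P s Q \<Longrightarrow> (\<And>t s'. Q t s' \<Longrightarrow> Q' t s') \<Longrightarrow> wp q P s Q'"
  unfolding wp_def by blast

text \<open>The potential \<open>\<Phi>\<close> pays for the loop, one unit per evaluation of the test included.\<close>

lemma wp_While:
  assumes "Inv s"
    and body: "\<And>s. Inv s \<Longrightarrow> tval q s b \<Longrightarrow> wp q P s (\<lambda>t s'. Inv s' \<and> t + \<Phi> s' < \<Phi> s)"
  shows "wp q (While b P) s (\<lambda>t s'. Inv s' \<and> \<not> tval q s' b \<and> t + \<Phi> s' \<le> \<Phi> s + 1)"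
  using \<open>Inv s\<close>
\<comment> \<open>The strict decrease of \<Phi> also gives termination. The extra unit in the
  conclusion is the last, failing test.\<close>
proof (induction "\<Phi> s" arbitrary: s rule: less_induct)
  case less
  show ?case
  proof (cases "tval q s b")
    case True
    from body[OF less.prems True] obtain t s'
      where 1: "exec q P s t s'" "Inv s'" "t + \<Phi> s' < \<Phi> s" unfolding wp_def by blast
    with less.hyps[of s'] obtain t' s''
      where 2: "exec q (While b P) s' t' s''" "Inv s''" "\<not> tval q s'' b" "t' + \<Phi> s'' \<le> \<Phi> s' + 1"
      unfolding wp_def by auto
    have "1 + t + t' + \<Phi> s'' \<le> \<Phi> s + 1" using 1(3) 2(4) by linarith
    then show ?thesis unfolding wp_def using exec_While_True[OF True 1(1) 2(1)] 2(2,3) by blast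
  next
    case False
    then show ?thesis unfolding wp_def using exec_While_False[OF False] less.prems
      by (intro exI[of _ 1] exI[of _ s]) simp
  qed
qed

text \<open>An array used as a stack holds its height in cell 0 and its bottom element in cell 1.\<close>

definition stack :: "(nat \<Rightarrow> nat) \<Rightarrow> nat list" where
  "stack f = map f [1..<Suc (f 0)]"

lemma length_stack [simp]: "length (stack f) = f 0"
  by (simp add: stack_def)

lemma stack_push: "stack (f(0 := Suc (f 0), Suc (f 0) := v)) = stack f @ [v]"
  by (simp add: stack_def)

lemma stack_pop: "0 < f 0 \<Longrightarrow> stack f = stack (f(0 := f 0 - 1)) @ [f (f 0)]"
  by (cases "f 0") (simp_all add: stack_def)

lemma stack_empty [simp]: "f 0 = 0 \<Longrightarrow> stack f = []"
  by (simp add: stack_def)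

section \<open>Search for a minimal set of roots\<close>

definition push :: "string \<Rightarrow> nexp \<Rightarrow> com" where
  "push x a = Seq (Assign x (Const 0) (Succ (Cell x (Const 0)))) (Assign x (Cell x (Const 0)) a)"

definition pop :: "string \<Rightarrow> com" where
  "pop x = Seq (Assign ''node'' (Const 0) (Cell x (Cell x (Const 0))))
     (Assign x (Const 0) (Pred (Cell x (Const 0))))"

text \<open>A node is marked when it is pushed, not when it is popped, so it enters the work stack
  at most once per mark array.\<close>

definition scan_arcs :: "string \<Rightarrow> com" where
  "scan_arcs mark =
     Seq (Assign ''arc'' (Const 0) (Cell ''first_arc'' (Cell ''node'' (Const 0))))
       (While (Less (Cell ''arc'' (Const 0)) (Cell ''first_arc'' (Succ (Cell ''node'' (Const 0)))))
         (Seq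
           (If (And (Not (QLess (QCell ''weight'' (Cell ''arc'' (Const 0))) (QConst 1)))
                 (Less (Cell mark (Cell ''head'' (Cell ''arc'' (Const 0)))) (Const 1)))
             (Seq (Assign mark (Cell ''head'' (Cell ''arc'' (Const 0))) (Const 1))
               (push ''work'' (Cell ''head'' (Cell ''arc'' (Const 0)))))
             Skip)
           (Assign ''arc'' (Const 0) (Succ (Cell ''arc'' (Const 0))))))"

definition search :: "string \<Rightarrow> com" where
  "search mark = While (Less (Const 0) (Cell ''work'' (Const 0))) (Seq (pop ''work'') (scan_arcs mark))"

text \<open>Candidates are popped from \<open>src\<close> and roots are pushed to
  \<open>out\<close>, so a second pass over the output of the first one automatically handles the
  roots in reverse order.\<close>

definition find_roots :: "string \<Rightarrow> string \<Rightarrow> string \<Rightarrow> com" where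
  "find_roots src mark out =
     While (Less (Const 0) (Cell src (Const 0)))
       (Seq (pop src)
         (If (Less (Cell mark (Cell ''node'' (Const 0))) (Const 1))
           (Seq (Assign mark (Cell ''node'' (Const 0)) (Const 1))
             (Seq (push ''work'' (Cell ''node'' (Const 0)))
               (Seq (push out (Cell ''node'' (Const 0))) (search mark))))
           Skip))"

section \<open>Search invariants and amortized running time\<close>

locale arc_arrays =
  fixes q :: rat_memory and first head :: "nat \<Rightarrow> nat" and n :: nat
  assumes first_mono: "u < n \<Longrightarrow> first u \<le> first (Suc u)"
    and head_less: "u < n \<Longrightarrow> e < first (Suc u) \<Longrightarrow> head e < n"
begin

text \<open>The counterpart of \<open>sure_arcs\<close> on node numbers; \<open>arcs_iff\<close>
  below makes the correspondence precise.\<close>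

definition arcs :: "nat rel" where
  "arcs = {(u, head e) | u e. u < n \<and> first u \<le> e \<and> e < first (Suc u) \<and> 1 \<le> q ''weight'' e}"

definition marked :: "(nat \<Rightarrow> nat) \<Rightarrow> nat set" where
  "marked m = {v. m v \<noteq> 0}"

text \<open>An unmarked node may yet be pushed and a stacked one will be popped, so these nodes can
  still cause scanning work.\<close>

definition pending :: "(nat \<Rightarrow> nat) \<Rightarrow> (nat \<Rightarrow> nat) \<Rightarrow> nat set" where
  "pending m k = {..<n} - marked m \<union> set (stack k)"

text \<open>An arc costs at most 6: a loop test and five steps of the body. A node costs 5 more: the
  test in \<open>search\<close>, two assignments of \<open>pop\<close>, the initialisation of
  \<open>arc\<close> and the failing test that ends the scan.\<close>

definition potential :: "(nat \<Rightarrow> nat) \<Rightarrow> (nat \<Rightarrow> nat) \<Rightarrow> nat" where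
  "potential m k = (\<Sum>v\<in>pending m k. 6 * (first (Suc v) - first v) + 5)"

text \<open>\<open>U\<close> holds the marked nodes whose arcs have not all been followed yet.\<close>

definition search_inv :: "nat set \<Rightarrow> nat set \<Rightarrow> (nat \<Rightarrow> nat) \<Rightarrow> (nat \<Rightarrow> nat) \<Rightarrow> bool" where
  "search_inv R U m k \<longleftrightarrow> distinct (stack k) \<and> set (stack k) \<subseteq> marked m \<and> marked m \<subseteq> {..<n} \<and>
     marked m \<subseteq> arcs\<^sup>* `` R \<and> arcs `` (marked m - U) \<subseteq> marked m"

lemma marked_update [simp]: "marked (m(v := Suc x)) = insert v (marked m)"
  by (auto simp: marked_def)

text \<open>The node moves from the unmarked part of \<open>pending\<close> to the stacked part, so
  a push leaves the budget for scanning intact.\<close>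

lemma potential_push [simp]:
  assumes "v < n" "v \<notin> marked m"
  shows "potential (m(v := Suc x)) (k(0 := Suc (k 0), Suc (k 0) := v)) = potential m k"
proof -
  have "pending (m(v := Suc x)) (k(0 := Suc (k 0), Suc (k 0) := v)) = pending m k"
    using assms by (auto simp: pending_def stack_push)
  then show ?thesis by (simp add: potential_def)
qed

text \<open>The popped node is marked and, the stack being distinct, does not occur further down. It
  therefore leaves \<open>pending\<close>, and its share of the potential pays for scanning its
  arcs.\<close>

lemma potential_pop:
  assumes inv: "search_inv R (set (stack k)) m k" and k: "0 < k 0" "u = k (k 0)"
  shows "potential m k = potential m (k(0 := k 0 - 1)) + 6 * (first (Suc u) - first u) + 5"
    and "search_inv R (insert u (set (stack (k(0 := k 0 - 1))))) m (k(0 := k 0 - 1))"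
    and "u \<in> marked m" "u \<notin> set (stack (k(0 := k 0 - 1)))"
proof -
  note st = stack_pop[of k, OF k(1), folded k(2)]
  show u: "u \<in> marked m" "u \<notin> set (stack (k(0 := k 0 - 1)))"
    using inv st unfolding search_inv_def by auto
  then have "pending m k = insert u (pending m (k(0 := k 0 - 1)))"
    "u \<notin> pending m (k(0 := k 0 - 1))"
    by (auto simp: pending_def st simp del: fun_upd_apply)
  moreover have "finite (pending m (k(0 := k 0 - 1)))" by (simp add: pending_def)
  ultimately show "potential m k = potential m (k(0 := k 0 - 1)) + 6 * (first (Suc u) - first u) + 5"
    by (simp add: potential_def)
  show "search_inv R (insert u (set (stack (k(0 := k 0 - 1))))) m (k(0 := k 0 - 1))"
    using inv unfolding search_inv_def st by auto
qed

lemma search_inv_mono: "search_inv R U m k \<Longrightarrow> R \<subseteq> R' \<Longrightarrow> search_inv R' U m k"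
  unfolding search_inv_def by (meson Image_mono order_refl order_trans)

lemma search_inv_push:
  assumes "search_inv R U m k" "v < n" "v \<notin> marked m" "v \<in> arcs\<^sup>* `` R"
  shows "search_inv R (insert v U) (m(v := Suc x)) (k(0 := Suc (k 0), Suc (k 0) := v))"
  using assms unfolding search_inv_def stack_push marked_update by auto

lemma wp_scan_arcs:
  assumes mark: "mark \<notin> {''work'', ''arc'', ''node'', ''first_arc'', ''head''}"
    and arrays: "s ''first_arc'' = first" "s ''head'' = head"
    and u: "s ''node'' 0 = u" "u \<in> marked (s mark)" "u \<notin> set (stack (s ''work''))"
    and inv: "search_inv R (insert u (set (stack (s ''work'')))) (s mark) (s ''work'')"
  shows "wp q (scan_arcs mark) s (\<lambda>t s'.
    search_inv R (set (stack (s' ''work''))) (s' mark) (s' ''work'') \<and>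
    marked (s mark) \<subseteq> marked (s' mark) \<and>
    (\<forall>x. x \<notin> {mark, ''work'', ''arc''} \<longrightarrow> s' x = s x) \<and>
    t + potential (s' mark) (s' ''work'') \<le>
      potential (s mark) (s ''work'') + 6 * (first (Suc u) - first u) + 2)"
proof -
  have ne: "mark \<noteq> ''work''" "mark \<noteq> ''arc''" "mark \<noteq> ''node''" "mark \<noteq> ''first_arc''"
    "mark \<noteq> ''head''" "''work'' \<noteq> mark" "''arc'' \<noteq> mark" "''node'' \<noteq> mark"
    "''first_arc'' \<noteq> mark" "''head'' \<noteq> mark"
    using mark by auto
  \<comment> \<open>Midway through the scan only arcs numbered below the counter are known to lead
    to marked nodes, so \<open>u\<close> stays in the exceptional set although it is off the
    stack.\<close>
  define Inv where "Inv s' \<longleftrightarrow>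
    search_inv R (insert u (set (stack (s' ''work'')))) (s' mark) (s' ''work'') \<and>
    marked (s mark) \<subseteq> marked (s' mark) \<and> u \<notin> set (stack (s' ''work'')) \<and>
    (\<forall>x. x \<notin> {mark, ''work'', ''arc''} \<longrightarrow> s' x = s x) \<and>
    first u \<le> s' ''arc'' 0 \<and> s' ''arc'' 0 \<le> first (Suc u) \<and>
    (\<forall>e. first u \<le> e \<and> e < s' ''arc'' 0 \<and> 1 \<le> q ''weight'' e \<longrightarrow> head e \<in> marked (s' mark))" for s'
  define \<Phi> where "\<Phi> s' = potential (s' mark) (s' ''work'') + 6 * (first (Suc u) - s' ''arc'' 0)" for s'
  have un: "u < n" using inv u(2) by (auto simp: search_inv_def)
  let ?s = "s(''arc'' := (s ''arc'')(0 := first u))"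
  have init: "Inv ?s" using ne u inv first_mono[OF un] by (auto simp: Inv_def)
  let ?b = "Less (Cell ''arc'' (Const 0)) (Cell ''first_arc'' (Succ (Cell ''node'' (Const 0))))"
  let ?P = "Seq (If (And (Not (QLess (QCell ''weight'' (Cell ''arc'' (Const 0))) (QConst 1)))
                 (Less (Cell mark (Cell ''head'' (Cell ''arc'' (Const 0)))) (Const 1)))
             (Seq (Assign mark (Cell ''head'' (Cell ''arc'' (Const 0))) (Const 1))
               (push ''work'' (Cell ''head'' (Cell ''arc'' (Const 0)))))
             Skip)
           (Assign ''arc'' (Const 0) (Succ (Cell ''arc'' (Const 0))))"
  have body: "wp q ?P s1 (\<lambda>t s2. Inv s2 \<and> t + \<Phi> s2 < \<Phi> s1)" if s1: "Inv s1" "tval q s1 ?b" for s1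
  proof -
    define e where "e = s1 ''arc'' 0"
    note I = s1(1)[unfolded Inv_def, folded e_def]
    have fr: "s1 ''first_arc'' = first" "s1 ''head'' = head" "s1 ''node'' 0 = u"
      using I ne arrays u(1) by auto
    have e: "first u \<le> e" "e < first (Suc u)" using I s1(2) fr by (simp_all add: e_def)
    have arc: "(u, head e) \<in> arcs" if "1 \<le> q ''weight'' e"
      using that e un by (auto simp: arcs_def)
    have u1: "u \<in> marked (s1 mark)" using I u(2) by blast
    have hn: "head e < n" using head_less[OF un e(2)] .
    show ?thesis
    proof (cases "1 \<le> q ''weight'' e \<and> head e \<notin> marked (s1 mark)")
      case True
      have "u \<in> arcs\<^sup>* `` R" using u1 I unfolding search_inv_def by blast
      then have "head e \<in> arcs\<^sup>* `` R"
        using arc True by (blast intro: rtrancl.rtrancl_into_rtrancl)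
      note new = search_inv_push[OF I[THEN conjunct1] hn _ this, of 0]
      \<comment> \<open>This keeps \<open>u\<close> from being pushed again.\<close>
      have hu: "head e \<noteq> u" using True u1 by blast
      have m0: "s1 mark (head e) = 0" using True by (simp add: marked_def)
      let ?s2 = "s1(mark := (s1 mark)(head e := Suc 0),
        ''work'' := (s1 ''work'')(0 := Suc (s1 ''work'' 0), Suc (s1 ''work'' 0) := head e),
        ''arc'' := (s1 ''arc'')(0 := Suc e))"
      have "wp q ?P s1 Q \<longleftrightarrow> Q 5 ?s2" for Q
        using True m0 fr ne by (simp add: push_def e_def[symmetric] numeral_eq_Suc)
      moreover have "Inv ?s2"
        using I ne new True e hu
        by (simp add: Inv_def stack_push insert_commute less_Suc_eq del: fun_upd_apply
            add: fun_upd_same fun_upd_other) (auto simp: less_Suc_eq)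
      moreover have "5 + \<Phi> ?s2 < \<Phi> s1"
        using ne e hn True by (simp add: \<Phi>_def e_def[symmetric] del: fun_upd_apply
            add: fun_upd_same fun_upd_other)
      ultimately show ?thesis by (simp only: simp_thms)
    next
      case False
      then show ?thesis
        using I fr ne e e_def[symmetric]
        by (auto simp: Inv_def \<Phi>_def marked_def less_Suc_eq)
    qed
  qed
  have post: "search_inv R (set (stack (s' ''work''))) (s' mark) (s' ''work'')"
    if "Inv s'" "\<not> tval q s' ?b" for s'
  proof -
    note I = that(1)[unfolded Inv_def]
    have "s' ''first_arc'' = first" "s' ''node'' 0 = u" using I ne arrays u(1) by auto
    \<comment> \<open>The counter has passed every arc of \<open>u\<close>, so \<open>u\<close> can
      leave the exceptional set.\<close>
    then have "arcs `` {u} \<subseteq> marked (s' mark)" using that(2) I by (auto simp: arcs_def)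
    then show ?thesis using I unfolding search_inv_def by blast
  qed
  have "wp q (While ?b ?P) ?s (\<lambda>t s'. Inv s' \<and> \<not> tval q s' ?b \<and> t + \<Phi> s' \<le> \<Phi> ?s + 1)"
    by (rule wp_While[OF init body])
  then have "wp q (While ?b ?P) ?s (\<lambda>t s'.
    search_inv R (set (stack (s' ''work''))) (s' mark) (s' ''work'') \<and>
    marked (s mark) \<subseteq> marked (s' mark) \<and>
    (\<forall>x. x \<notin> {mark, ''work'', ''arc''} \<longrightarrow> s' x = s x) \<and>
    1 + t + potential (s' mark) (s' ''work'') \<le>
      potential (s mark) (s ''work'') + 6 * (first (Suc u) - first u) + 2)"
    by (rule wp_mono) (use post ne in \<open>auto simp: Inv_def \<Phi>_def\<close>)
  then show ?thesis by (simp add: scan_arcs_def arrays u(1))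
qed

text \<open>With the stack empty no exceptional nodes remain, so the marked set is closed. Time is
  charged to the drop in potential plus one failing test, which lets successive searches share one
  budget.\<close>

lemma wp_search:
  assumes mark: "mark \<notin> {''work'', ''arc'', ''node'', ''first_arc'', ''head''}"
    and arrays: "s ''first_arc'' = first" "s ''head'' = head"
    and inv: "search_inv R (set (stack (s ''work''))) (s mark) (s ''work'')"
  shows "wp q (search mark) s (\<lambda>t s'. s' ''work'' 0 = 0 \<and>
    search_inv R {} (s' mark) (s' ''work'') \<and> marked (s mark) \<subseteq> marked (s' mark) \<and>
    (\<forall>x. x \<notin> {mark, ''work'', ''arc'', ''node''} \<longrightarrow> s' x = s x) \<and>
    t + potential (s' mark) (s' ''work'') \<le> potential (s mark) (s ''work'') + 1)"
proof -
  have ne: "mark \<noteq> ''work''" "mark \<noteq> ''arc''" "mark \<noteq> ''node''" "mark \<noteq> ''first_arc''"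
    "mark \<noteq> ''head''" "''work'' \<noteq> mark" "''arc'' \<noteq> mark" "''node'' \<noteq> mark"
    "''first_arc'' \<noteq> mark" "''head'' \<noteq> mark"
    using mark by auto
  define Inv where "Inv s' \<longleftrightarrow>
    search_inv R (set (stack (s' ''work''))) (s' mark) (s' ''work'') \<and>
    marked (s mark) \<subseteq> marked (s' mark) \<and>
    (\<forall>x. x \<notin> {mark, ''work'', ''arc'', ''node''} \<longrightarrow> s' x = s x)" for s'
  let ?b = "Less (Const 0) (Cell ''work'' (Const 0))"
  let ?P = "Seq (pop ''work'') (scan_arcs mark)"
  let ?\<Phi> = "\<lambda>s. potential (s mark) (s ''work'')"
  have body: "wp q ?P s1 (\<lambda>t s2. Inv s2 \<and> t + ?\<Phi> s2 < ?\<Phi> s1)" if s1: "Inv s1" "tval q s1 ?b" for s1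
  proof -
    define k where "k = s1 ''work''"
    define u where "u = k (k 0)"
    note I = s1(1)[unfolded Inv_def]
    have k0: "0 < k 0" using s1(2) by (simp add: k_def)
    note p = potential_pop[OF I[THEN conjunct1, folded k_def] k0 u_def]
    let ?s2 = "s1(''node'' := (s1 ''node'')(0 := u), ''work'' := k(0 := k 0 - 1))"
    have fr: "?s2 ''first_arc'' = first" "?s2 ''head'' = head" using I ne arrays by auto
    have s2: "?s2 mark = s1 mark" "?s2 ''work'' = k(0 := k 0 - 1)" "?s2 ''node'' 0 = u"
      using ne by auto
    have "wp q (scan_arcs mark) ?s2 (\<lambda>t s'.
      search_inv R (set (stack (s' ''work''))) (s' mark) (s' ''work'') \<and>
      marked (?s2 mark) \<subseteq> marked (s' mark) \<and>
      (\<forall>x. x \<notin> {mark, ''work'', ''arc''} \<longrightarrow> s' x = ?s2 x) \<and>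
      t + potential (s' mark) (s' ''work'') \<le>
        potential (?s2 mark) (?s2 ''work'') + 6 * (first (Suc u) - first u) + 2)"
      by (rule wp_scan_arcs[OF mark fr]) (use p(2-4) in \<open>simp_all only: s2 not_False_eq_True\<close>)
    then have "wp q (scan_arcs mark) ?s2 (\<lambda>t s2. Inv s2 \<and> 2 + t + ?\<Phi> s2 < ?\<Phi> s1)"
      by (rule wp_mono) (use I ne p(1) in \<open>auto simp: Inv_def k_def\<close>)
    then show ?thesis by (simp add: pop_def k_def u_def)
  qed
  have "Inv s" using inv by (simp add: Inv_def)
  from wp_While[of Inv s q ?b ?P ?\<Phi>, OF this body]
  show ?thesis unfolding search_def
    by (rule wp_mono) (use ne in \<open>auto simp: Inv_def\<close>)
qed

text \<open>The roots form a sublist of the reversed source and so inherit any pairwise relation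
  \<open>Q\<close> from it. Leaving \<open>Q\<close> open lets the second pass retain what the first
  one established.\<close>

lemma wp_find_roots:
  assumes dist: "distinct [src, mark, out, ''work'', ''arc'', ''node'', ''first_arc'', ''head'']"
    and arrays: "s ''first_arc'' = first" "s ''head'' = head"
    and init: "s ''work'' 0 = 0" "s mark = (\<lambda>_. 0)" "s out 0 = 0"
    and src: "set (stack (s src)) \<subseteq> {..<n}" "sorted_wrt Q (rev (stack (s src)))"
  shows "wp q (find_roots src mark out) s (\<lambda>t s'. s' ''work'' 0 = 0 \<and>
    sorted_wrt Q (stack (s' out)) \<and> sorted_wrt (\<lambda>a b. (a, b) \<notin> arcs\<^sup>*) (stack (s' out)) \<and>
    set (stack (s' out)) \<subseteq> set (stack (s src)) \<and>
    set (stack (s src)) \<subseteq> arcs\<^sup>* `` set (stack (s' out)) \<and>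
    (\<forall>x. x \<notin> {src, mark, out, ''work'', ''arc'', ''node''} \<longrightarrow> s' x = s x) \<and>
    t \<le> (\<Sum>v<n. 6 * (first (Suc v) - first v) + 5) + 10 * length (stack (s src)) + 1)"
proof -
  have ne: "src \<noteq> mark" "src \<noteq> out" "mark \<noteq> out" "mark \<noteq> src" "out \<noteq> src" "out \<noteq> mark"
    "src \<noteq> ''work''" "src \<noteq> ''arc''" "src \<noteq> ''node''" "src \<noteq> ''first_arc''" "src \<noteq> ''head''"
    "mark \<noteq> ''work''" "mark \<noteq> ''arc''" "mark \<noteq> ''node''" "mark \<noteq> ''first_arc''" "mark \<noteq> ''head''"
    "out \<noteq> ''work''" "out \<noteq> ''arc''" "out \<noteq> ''node''" "out \<noteq> ''first_arc''" "out \<noteq> ''head''"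
    "''work'' \<noteq> src" "''arc'' \<noteq> src" "''node'' \<noteq> src" "''first_arc'' \<noteq> src" "''head'' \<noteq> src"
    "''work'' \<noteq> mark" "''arc'' \<noteq> mark" "''node'' \<noteq> mark" "''first_arc'' \<noteq> mark" "''head'' \<noteq> mark"
    "''work'' \<noteq> out" "''arc'' \<noteq> out" "''node'' \<noteq> out" "''first_arc'' \<noteq> out" "''head'' \<noteq> out"
    using dist by auto
  \<comment> \<open>With the roots found so far placed before the reversed rest of the source, the
    next candidate stands at the seam: accepting it leaves the list unchanged, rejecting it deletes
    one entry.\<close>
  define Inv where "Inv s' \<longleftrightarrow> s' ''work'' 0 = 0 \<and>
    search_inv (set (stack (s' out))) {} (s' mark) (s' ''work'') \<and>
    set (stack (s' out)) \<subseteq> marked (s' mark) \<and>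
    sorted_wrt Q (stack (s' out) @ rev (stack (s' src))) \<and>
    sorted_wrt (\<lambda>a b. (a, b) \<notin> arcs\<^sup>*) (stack (s' out)) \<and>
    set (stack (s' src)) \<union> set (stack (s' out)) \<subseteq> set (stack (s src)) \<and>
    set (stack (s src)) \<subseteq> set (stack (s' src)) \<union> marked (s' mark) \<and>
    (\<forall>x. x \<notin> {src, mark, out, ''work'', ''arc'', ''node''} \<longrightarrow> s' x = s x)" for s'
  \<comment> \<open>Ten units per candidate: the loop test, \<open>pop\<close> with 2, the
    conditional, the marking, two pushes with 2 each, and the failing test of
    \<open>search\<close>.\<close>
  let ?\<Phi> = "\<lambda>s'. potential (s' mark) (s' ''work'') + 10 * s' src 0"
  let ?b = "Less (Const 0) (Cell src (Const 0))"
  let ?P = "Seq (pop src)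
         (If (Less (Cell mark (Cell ''node'' (Const 0))) (Const 1))
           (Seq (Assign mark (Cell ''node'' (Const 0)) (Const 1))
             (Seq (push ''work'' (Cell ''node'' (Const 0)))
               (Seq (push out (Cell ''node'' (Const 0))) (search mark))))
           Skip)"
  have "Inv s" using init src by (simp add: Inv_def search_inv_def marked_def)
  moreover have "wp q ?P s1 (\<lambda>t s2. Inv s2 \<and> t + ?\<Phi> s2 < ?\<Phi> s1)"
    if s1: "Inv s1" "tval q s1 ?b" for s1
  proof -
    define l where "l = s1 src"
    define u where "u = l (l 0)"
    define l' where "l' = l(0 := l 0 - 1)"
    define k where "k = s1 ''work''"
    define m where "m = s1 mark"
    define r where "r = s1 out"
    note I = s1(1)[unfolded Inv_def, folded l_def m_def k_def r_def]
    have l0: "0 < l 0" using s1(2) by (simp add: l_def)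
    then have l': "l' 0 < l 0" by (simp add: l'_def)
    have st: "stack l = stack l' @ [u]" using stack_pop[of l, OF l0] by (simp add: l'_def u_def)
    have un: "u < n" "u \<in> set (stack (s src))" using I src st by auto
    let ?sa = "s1(''node'' := (s1 ''node'')(0 := u), src := l')"
    have pop: "wp q ?P s1 Q \<longleftrightarrow> wp q (If (Less (Cell mark (Cell ''node'' (Const 0))) (Const 1))
           (Seq (Assign mark (Cell ''node'' (Const 0)) (Const 1))
             (Seq (push ''work'' (Cell ''node'' (Const 0)))
               (Seq (push out (Cell ''node'' (Const 0))) (search mark))))
           Skip) ?sa (\<lambda>t. Q (2 + t))" for Q
      using ne by (simp only: pop_def wp_Seq wp_Assign) (simp add: l_def u_def l'_def)
    show ?thesis
    proof (cases "m u = 0")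
      case True
      then have um: "u \<notin> marked m" by (simp add: marked_def)
      let ?m = "m(u := Suc 0)"
      let ?k = "k(0 := Suc (k 0), Suc (k 0) := u)"
      let ?r = "r(0 := Suc (r 0), Suc (r 0) := u)"
      let ?s2 = "?sa(mark := ?m, ''work'' := ?k, out := ?r)"
      have k0: "stack k = []" using I by simp
      have s2: "?s2 mark = ?m" "?s2 ''work'' = ?k" "?s2 out = ?r" "?s2 src = l'"
        "?s2 ''first_arc'' = first" "?s2 ''head'' = head"
        using ne I arrays by simp_all
      have "search_inv (set (stack ?r)) {} m k"
        using I by (auto simp: stack_push intro: search_inv_mono[of "set (stack r)"])
      then have "search_inv (set (stack ?r)) {u} ?m ?k"
        using un um by (intro search_inv_push) (auto simp: stack_push)
      then have inv2: "search_inv (set (stack ?r)) (set (stack (?s2 ''work''))) (?s2 mark) (?s2 ''work'')"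
        using k0 by (simp only: s2 stack_push) simp
      \<comment> \<open>Every earlier search has run to completion. Hence a node still unmarked
        cannot be reached from any earlier root.\<close>
      have closed: "arcs\<^sup>* `` marked m = marked m"
        using I by (intro Image_closed_trancl) (simp add: search_inv_def)
      have unreach: "(a, u) \<notin> arcs\<^sup>*" if "a \<in> set (stack r)" for a
      proof
        assume "(a, u) \<in> arcs\<^sup>*"
        moreover have "a \<in> marked m" using that I by blast
        ultimately have "u \<in> arcs\<^sup>* `` marked m" by blast
        then show False using closed um by simp
      qed
      have mark': "mark \<notin> {''work'', ''arc'', ''node'', ''first_arc'', ''head''}" using ne by simp
      have "wp q (search mark) ?s2 (\<lambda>t s'. Inv s' \<and> 8 + t + ?\<Phi> s' < ?\<Phi> s1)"
      proof (rule wp_mono[OF wp_search[OF mark' s2(5,6) inv2]], elim conjE, unfold s2, goal_cases)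
        case (1 t s')
        have fr: "s' out = ?r" "s' src = l'"
          "\<forall>x. x \<notin> {src, mark, out, ''work'', ''arc'', ''node''} \<longrightarrow> s' x = s x"
          using 1(4) I ne by auto
        have marks: "insert u (marked m) \<subseteq> marked (s' mark)" using 1(3) by (simp only: marked_update)
        have "sorted_wrt (\<lambda>a b. (a, b) \<notin> arcs\<^sup>*) (stack ?r)"
          using I unreach by (simp add: stack_push sorted_wrt_append del: fun_upd_apply)
        moreover have "sorted_wrt Q (stack ?r @ rev (stack l'))"
          using I by (simp add: stack_push st del: fun_upd_apply)
        moreover have "set (stack (s src)) \<subseteq> set (stack l') \<union> marked (s' mark)"
          using I marks unfolding st by auto
        moreover have "set (stack l') \<union> set (stack ?r) \<subseteq> set (stack (s src))"
          using I by (auto simp: stack_push st simp del: fun_upd_apply)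
        moreover have "set (stack ?r) \<subseteq> marked (s' mark)"
          using I marks unfolding stack_push by auto
        ultimately have "Inv s'" unfolding Inv_def fr(1,2) using 1(1,2) fr(3) by simp
        moreover have "8 + t + ?\<Phi> s' < ?\<Phi> s1"
          using 1(5) l' unfolding potential_push[OF un(1) um] by (simp add: fr l_def[symmetric] m_def[symmetric] k_def[symmetric])
        ultimately show ?case ..
      qed
      moreover have "wp q ?P s1 Q \<longleftrightarrow> wp q (search mark) ?s2 (\<lambda>t. Q (8 + t))" for Q
        unfolding pop using True ne
        by (simp add: push_def m_def k_def r_def fun_upd_twist numeral_eq_Suc)
      ultimately show ?thesis by (simp only: simp_thms)
    next
      case False
      then have um: "u \<in> marked m" by (simp add: marked_def)
      have sa: "?sa mark = m" "?sa ''work'' = k" "?sa out = r" "?sa src = l'"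
        "\<forall>x. x \<notin> {src, mark, out, ''work'', ''arc'', ''node''} \<longrightarrow> ?sa x = s x"
        using ne I by (auto simp: m_def k_def r_def)
      have "sorted_wrt Q (stack r @ rev (stack l'))"
        using I by (simp add: st sorted_wrt_append)
      then have "Inv ?sa" unfolding Inv_def sa using I um sa(5) by (auto simp: st simp del: fun_upd_apply)
      moreover have "4 + ?\<Phi> ?sa < ?\<Phi> s1"
        unfolding sa using l' by (simp add: l_def[symmetric] m_def[symmetric] k_def[symmetric])
      moreover have "wp q ?P s1 Q \<longleftrightarrow> Q 4 ?sa" for Q
        unfolding pop using False ne by (simp add: m_def numeral_eq_Suc)
      ultimately show ?thesis by (simp only: simp_thms)
    qed
  qed
  ultimately have "wp q (find_roots src mark out) s
      (\<lambda>t s'. Inv s' \<and> \<not> tval q s' ?b \<and> t + ?\<Phi> s' \<le> ?\<Phi> s + 1)"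
    unfolding find_roots_def by (rule wp_While)
  then show ?thesis
  proof (rule wp_mono, goal_cases)
    case (1 t s')
    have h: "Inv s'" "\<not> tval q s' ?b" "t + ?\<Phi> s' \<le> ?\<Phi> s + 1"
      using 1 by blast+
    note I = h(1)[unfolded Inv_def]
    have "stack (s' src) = []" using h(2) by simp
    \<comment> \<open>All nodes are unmarked at the start, so the initial potential is the full sum
      over the nodes.\<close>
    moreover have "pending (s mark) (s ''work'') = {..<n}"
      using init by (simp add: pending_def marked_def)
    then have "t \<le> (\<Sum>v<n. 6 * (first (Suc v) - first v) + 5) + 10 * length (stack (s src)) + 1"
      using h(3) by (simp add: potential_def)
    moreover have "sorted_wrt Q (stack (s' out))" using I by (simp add: sorted_wrt_append)
    moreover have "marked (s' mark) \<subseteq> arcs\<^sup>* `` set (stack (s' out))"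
      using I by (simp add: search_inv_def)
    ultimately show ?case using I by auto
  qed
qed

end

section \<open>Closedness of the targets and the complete program\<close>

definition check_arcs :: com where
  "check_arcs =
     Seq (Assign ''arc'' (Const 0) (Cell ''first_arc'' (Cell ''i'' (Const 0))))
       (While (Less (Cell ''arc'' (Const 0)) (Cell ''first_arc'' (Succ (Cell ''i'' (Const 0)))))
         (Seq
           (If (Less (Const 0) (Cell ''target'' (Cell ''head'' (Cell ''arc'' (Const 0)))))
             Skip (Assign ''escape'' (Const 0) (Const 1)))
           (Assign ''arc'' (Const 0) (Succ (Cell ''arc'' (Const 0))))))"

definition collect_targets :: com where
  "collect_targets =
     While (Less (Cell ''i'' (Const 0)) (Cell ''nodes'' (Const 0)))
       (Seq
         (If (Less (Const 0) (Cell ''target'' (Cell ''i'' (Const 0))))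
           (Seq (push ''roots0'' (Cell ''i'' (Const 0))) check_arcs) Skip)
         (Assign ''i'' (Const 0) (Succ (Cell ''i'' (Const 0)))))"

text \<open>Cell 0 of \<open>roots2\<close> is a stack height, hence the number of roots. The passes
  have separate mark arrays because each must start with all marks zero.\<close>

definition effectors_program :: com where
  "effectors_program =
     Seq collect_targets
       (Seq (find_roots ''roots0'' ''mark1'' ''roots1'')
         (Seq (find_roots ''roots1'' ''mark2'' ''roots2'')
           (If (And (Less (Cell ''escape'' (Const 0)) (Const 1))
                 (Not (Less (Cell ''budget'' (Const 0)) (Cell ''roots2'' (Const 0)))))
             (Assign ''result'' (Const 0) (Const 1)) Skip)))"

context arc_arrays
begin

text \<open>An arc of any weight may succeed, so closedness is checked without looking at weights.
  Each arc costs 4: loop test, conditional, its branch, increment.\<close>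

lemma wp_check_arcs:
  assumes arrays: "s ''first_arc'' = first" "s ''head'' = head"
    and u: "s ''i'' 0 = u" "u < n"
  shows "wp q check_arcs s (\<lambda>t s'.
    (s' ''escape'' 0 = 0 \<longleftrightarrow> s ''escape'' 0 = 0 \<and>
      (\<forall>e. first u \<le> e \<and> e < first (Suc u) \<longrightarrow> s ''target'' (head e) \<noteq> 0)) \<and>
    (\<forall>x. x \<notin> {''arc'', ''escape''} \<longrightarrow> s' x = s x) \<and>
    t \<le> 4 * (first (Suc u) - first u) + 2)"
proof -
  define Inv where "Inv s' \<longleftrightarrow> first u \<le> s' ''arc'' 0 \<and> s' ''arc'' 0 \<le> first (Suc u) \<and>
    (s' ''escape'' 0 = 0 \<longleftrightarrow> s ''escape'' 0 = 0 \<and>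
      (\<forall>e. first u \<le> e \<and> e < s' ''arc'' 0 \<longrightarrow> s ''target'' (head e) \<noteq> 0)) \<and>
    (\<forall>x. x \<notin> {''arc'', ''escape''} \<longrightarrow> s' x = s x)" for s'
  let ?\<Phi> = "\<lambda>s'. 4 * (first (Suc u) - s' ''arc'' 0)"
  let ?b = "Less (Cell ''arc'' (Const 0)) (Cell ''first_arc'' (Succ (Cell ''i'' (Const 0))))"
  let ?P = "Seq
           (If (Less (Const 0) (Cell ''target'' (Cell ''head'' (Cell ''arc'' (Const 0)))))
             Skip (Assign ''escape'' (Const 0) (Const 1)))
           (Assign ''arc'' (Const 0) (Succ (Cell ''arc'' (Const 0))))"
  let ?s = "s(''arc'' := (s ''arc'')(0 := first u))"
  have "Inv ?s" using first_mono[OF u(2)] by (auto simp: Inv_def)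
  moreover have "wp q ?P s1 (\<lambda>t s2. Inv s2 \<and> t + ?\<Phi> s2 < ?\<Phi> s1)"
    if s1: "Inv s1" "tval q s1 ?b" for s1
  proof -
    define e where "e = s1 ''arc'' 0"
    note I = s1(1)[unfolded Inv_def, folded e_def]
    have fr: "s1 ''first_arc'' = first" "s1 ''head'' = head" "s1 ''target'' = s ''target''"
      "s1 ''i'' 0 = u"
      using I arrays u(1) by simp_all
    have e: "first u \<le> e" "e < first (Suc u)" using I s1(2) fr by (simp_all add: e_def)
    have split: "(\<forall>e'. first u \<le> e' \<and> e' < Suc e \<longrightarrow> P e') \<longleftrightarrow>
        P e \<and> (\<forall>e'. first u \<le> e' \<and> e' < e \<longrightarrow> P e')" for P
      using e(1) by (auto simp: less_Suc_eq)
    \<comment> \<open>Both branches take one step, so a single successor state covers them.\<close>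
    define c where "c = (if s ''target'' (head e) = 0 then (s1 ''escape'')(0 := 1) else s1 ''escape'')"
    let ?s2 = "s1(''escape'' := c, ''arc'' := (s1 ''arc'')(0 := Suc e))"
    have "c 0 = 0 \<longleftrightarrow> s ''escape'' 0 = 0 \<and>
        (\<forall>e'. first u \<le> e' \<and> e' < Suc e \<longrightarrow> s ''target'' (head e') \<noteq> 0)"
      unfolding split using I by (simp add: c_def conj_commute)
    then have "Inv ?s2" using I e by (simp add: Inv_def)
    moreover have "3 + ?\<Phi> ?s2 < ?\<Phi> s1" using e by (simp add: e_def[symmetric])
    moreover have "wp q ?P s1 Q \<longleftrightarrow> Q 3 ?s2" for Q
      using fr by (simp add: c_def e_def[symmetric] numeral_eq_Suc)
    ultimately show ?thesis by (simp only: simp_thms)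
  qed
  ultimately have "wp q (While ?b ?P) ?s (\<lambda>t s'. Inv s' \<and> \<not> tval q s' ?b \<and> t + ?\<Phi> s' \<le> ?\<Phi> ?s + 1)"
    by (rule wp_While)
  then have "wp q (While ?b ?P) ?s (\<lambda>t s'.
    (s' ''escape'' 0 = 0 \<longleftrightarrow> s ''escape'' 0 = 0 \<and>
      (\<forall>e. first u \<le> e \<and> e < first (Suc u) \<longrightarrow> s ''target'' (head e) \<noteq> 0)) \<and>
    (\<forall>x. x \<notin> {''arc'', ''escape''} \<longrightarrow> s' x = s x) \<and>
    1 + t \<le> 4 * (first (Suc u) - first u) + 2)"
  proof (rule wp_mono, elim conjE, goal_cases)
    case (1 t s')
    then have "s' ''arc'' 0 = first (Suc u)" using arrays u(1) by (auto simp: Inv_def)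
    then show ?case using 1 by (simp add: Inv_def)
  qed
  then show ?thesis by (simp add: check_arcs_def arrays u(1))
qed

lemma wp_collect_targets:
  assumes arrays: "s ''first_arc'' = first" "s ''head'' = head" "s ''nodes'' 0 = n"
    and init: "s ''i'' 0 = 0" "s ''escape'' 0 = 0" "s ''roots0'' 0 = 0"
  shows "wp q collect_targets s (\<lambda>t s'.
    stack (s' ''roots0'') = filter (\<lambda>u. s ''target'' u \<noteq> 0) [0..<n] \<and>
    (s' ''escape'' 0 = 0 \<longleftrightarrow> (\<forall>u<n. s ''target'' u \<noteq> 0 \<longrightarrow>
      (\<forall>e. first u \<le> e \<and> e < first (Suc u) \<longrightarrow> s ''target'' (head e) \<noteq> 0))) \<and>
    (\<forall>x. x \<notin> {''arc'', ''escape'', ''i'', ''roots0''} \<longrightarrow> s' x = s x) \<and>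
    t \<le> (\<Sum>v<n. 4 * (first (Suc v) - first v) + 7) + 1)"
proof -
  define Inv where "Inv s' \<longleftrightarrow> s' ''i'' 0 \<le> n \<and>
    stack (s' ''roots0'') = filter (\<lambda>u. s ''target'' u \<noteq> 0) [0..<s' ''i'' 0] \<and>
    (s' ''escape'' 0 = 0 \<longleftrightarrow> (\<forall>u<s' ''i'' 0. s ''target'' u \<noteq> 0 \<longrightarrow>
      (\<forall>e. first u \<le> e \<and> e < first (Suc u) \<longrightarrow> s ''target'' (head e) \<noteq> 0))) \<and>
    (\<forall>x. x \<notin> {''arc'', ''escape'', ''i'', ''roots0''} \<longrightarrow> s' x = s x)" for s'
  \<comment> \<open>The 7 consists of the loop test, the conditional, \<open>push\<close> with 2,
    the fixed part 2 of \<open>check_arcs\<close>, and the increment.\<close>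
  let ?f = "\<lambda>v. 4 * (first (Suc v) - first v) + 7"
  let ?\<Phi> = "\<lambda>s'. \<Sum>v = s' ''i'' 0..<n. ?f v"
  let ?b = "Less (Cell ''i'' (Const 0)) (Cell ''nodes'' (Const 0))"
  let ?P = "Seq
         (If (Less (Const 0) (Cell ''target'' (Cell ''i'' (Const 0))))
           (Seq (push ''roots0'' (Cell ''i'' (Const 0))) check_arcs) Skip)
         (Assign ''i'' (Const 0) (Succ (Cell ''i'' (Const 0))))"
  have "Inv s" using init by (simp add: Inv_def)
  moreover have "wp q ?P s1 (\<lambda>t s2. Inv s2 \<and> t + ?\<Phi> s2 < ?\<Phi> s1)"
    if s1: "Inv s1" "tval q s1 ?b" for s1
  proof -
    define i where "i = s1 ''i'' 0"
    define k where "k = s1 ''roots0''"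
    note I = s1(1)[unfolded Inv_def, folded i_def k_def]
    have fr: "s1 ''first_arc'' = first" "s1 ''head'' = head" "s1 ''target'' = s ''target''"
      "s1 ''nodes'' 0 = n"
      using I arrays by simp_all
    have i: "i < n" using s1(2) fr by (simp add: i_def)
    have sum: "(\<Sum>v = i..<n. ?f v) = ?f i + (\<Sum>v = Suc i..<n. ?f v)"
      using i by (rule sum.atLeast_Suc_lessThan)
    show ?thesis
    proof (cases "s ''target'' i = 0")
      case True
      let ?s2 = "s1(''i'' := (s1 ''i'')(0 := Suc i))"
      have "Inv ?s2" using I True i by (auto simp: Inv_def less_Suc_eq k_def[symmetric])
      moreover have "3 + ?\<Phi> ?s2 < ?\<Phi> s1" using sum by (simp add: i_def[symmetric])
      moreover have "wp q ?P s1 Q \<longleftrightarrow> Q 3 ?s2" for Q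
        using True fr by (simp add: i_def[symmetric] numeral_eq_Suc)
      ultimately show ?thesis by (simp only: simp_thms)
    next
      case False
      let ?k = "k(0 := Suc (k 0), Suc (k 0) := i)"
      let ?s2 = "s1(''roots0'' := ?k)"
      let ?s3 = "\<lambda>s'. s'(''i'' := (s' ''i'')(0 := Suc (s' ''i'' 0)))"
      have s2: "?s2 ''first_arc'' = first" "?s2 ''head'' = head" "?s2 ''i'' 0 = i"
        using fr by (simp_all add: i_def)
      have "wp q check_arcs ?s2 (\<lambda>t s'. Inv (?s3 s') \<and> 4 + t + ?\<Phi> (?s3 s') < ?\<Phi> s1)"
      proof (rule wp_mono[OF wp_check_arcs[OF s2 i]], elim conjE, goal_cases)
        case (1 t s')
        have s': "s' ''i'' 0 = i" "s' ''roots0'' = ?k" using 1(2) s2(3) by (auto simp: fun_upd_def)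
        have "stack (s' ''roots0'') = filter (\<lambda>u. s ''target'' u \<noteq> 0) [0..<Suc i]"
          unfolding s'(2) stack_push using I False by simp
        moreover have "\<forall>x. x \<notin> {''arc'', ''escape'', ''i'', ''roots0''} \<longrightarrow> ?s3 s' x = s x"
          using I 1(2) by auto
        moreover have "s' ''escape'' 0 = 0 \<longleftrightarrow> (\<forall>u<Suc i. s ''target'' u \<noteq> 0 \<longrightarrow>
            (\<forall>e. first u \<le> e \<and> e < first (Suc u) \<longrightarrow> s ''target'' (head e) \<noteq> 0))"
          using 1(1) I False fr(3) by (simp add: All_less_Suc conj_commute)
        ultimately have "Inv (?s3 s')" using i s'(1) by (simp add: Inv_def)
        moreover have "4 + t + ?\<Phi> (?s3 s') < ?\<Phi> s1"
          using 1(3) sum s'(1) by (simp add: i_def[symmetric])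
        ultimately show ?case ..
      qed
      moreover have "wp q ?P s1 Q \<longleftrightarrow> wp q check_arcs ?s2 (\<lambda>t s'. Q (4 + t) (?s3 s'))" for Q
        using False fr by (simp add: i_def[symmetric] k_def push_def numeral_eq_Suc)
      ultimately show ?thesis by (simp only: simp_thms)
    qed
  qed
  ultimately have "wp q collect_targets s
      (\<lambda>t s'. Inv s' \<and> \<not> tval q s' ?b \<and> t + ?\<Phi> s' \<le> ?\<Phi> s + 1)"
    unfolding collect_targets_def by (rule wp_While)
  then show ?thesis
  proof (rule wp_mono, goal_cases)
    case (1 t s')
    have h: "Inv s'" "\<not> tval q s' ?b" "t + ?\<Phi> s' \<le> ?\<Phi> s + 1"
      using 1 by blast+
    note I = h(1)[unfolded Inv_def]
    have "s' ''nodes'' = s ''nodes''" using I by simp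
    then have i: "s' ''i'' 0 = n" using h(2) I arrays(3) by simp
    show ?case using I[unfolded i] h(3)[unfolded i init(1)] by (simp add: lessThan_atLeast0)
  qed
qed

text \<open>A telescoping sum; subtraction on naturals is truncated, so the induction carries
  \<open>first 0 \<le> first k\<close> along.\<close>

lemma sum_out_degrees: "(\<Sum>v<n. first (Suc v) - first v) = first n - first 0"
proof -
  have "(\<Sum>v<k. first (Suc v) - first v) = first k - first 0 \<and> first 0 \<le> first k" if "k \<le> n" for k
    using that
  proof (induction k)
    case (Suc k)
    then show ?case using first_mono[of k] by simp
  qed simp
  then show ?thesis by simp
qed

lemma wp_effectors_program:
  assumes arrays: "s ''first_arc'' = first" "s ''head'' = head" "s ''nodes'' 0 = n"
    and init: "\<And>x. x \<in> {''i'', ''escape'', ''work'', ''roots0'', ''roots1'', ''roots2'', ''mark1'', ''mark2'', ''result''} \<Longrightarrow> s x = (\<lambda>_. 0)"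
  shows "wp q effectors_program s (\<lambda>t s'. \<exists>K.
    sorted_wrt (\<lambda>a b. (a, b) \<notin> arcs\<^sup>*) K \<and> sorted_wrt (\<lambda>a b. (b, a) \<notin> arcs\<^sup>*) K \<and>
    set K \<subseteq> {u. u < n \<and> s ''target'' u \<noteq> 0} \<and>
    {u. u < n \<and> s ''target'' u \<noteq> 0} \<subseteq> arcs\<^sup>* `` set K \<and>
    s' ''result'' 0 = (if (\<forall>u<n. s ''target'' u \<noteq> 0 \<longrightarrow>
        (\<forall>e. first u \<le> e \<and> e < first (Suc u) \<longrightarrow> s ''target'' (head e) \<noteq> 0)) \<and>
      length K \<le> s ''budget'' 0 then 1 else 0) \<and>
    t \<le> 16 * first n + 37 * n + 5)"
proof -
  have s0: "s ''i'' 0 = 0" "s ''escape'' 0 = 0" "s ''roots0'' 0 = 0" using init by simp_all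
  let ?A = "{u. u < n \<and> s ''target'' u \<noteq> 0}"
  define closed where "closed \<longleftrightarrow> (\<forall>u<n. s ''target'' u \<noteq> 0 \<longrightarrow>
      (\<forall>e. first u \<le> e \<and> e < first (Suc u) \<longrightarrow> s ''target'' (head e) \<noteq> 0))"
  define b1 where "b1 = (\<Sum>v<n. 4 * (first (Suc v) - first v) + 7)"
  define b2 where "b2 = (\<Sum>v<n. 6 * (first (Suc v) - first v) + 5)"
  \<comment> \<open>Each arc contributes 4 once and 6 twice, each node 7 once and 5 twice.\<close>
  have "b1 + 2 * b2 = 16 * (first n - first 0) + 17 * n"
    unfolding sum_out_degrees[symmetric] b1_def b2_def
    by (simp add: sum.distrib sum_distrib_left[symmetric])
  then have time: "b1 + 2 * b2 \<le> 16 * first n + 17 * n" by simp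
  show ?thesis
    unfolding effectors_program_def wp_Seq
  proof (rule wp_mono[OF wp_collect_targets[OF arrays s0]], goal_cases)
    case (1 t1 s1)
    then have fr1: "\<forall>x. x \<notin> {''arc'', ''escape'', ''i'', ''roots0''} \<longrightarrow> s1 x = s x"
      and st1: "stack (s1 ''roots0'') = filter (\<lambda>u. s ''target'' u \<noteq> 0) [0..<n]"
      and es1: "s1 ''escape'' 0 = 0 \<longleftrightarrow> closed" and t1: "t1 \<le> b1 + 1"
      unfolding closed_def b1_def by blast+
    have s1: "s1 ''first_arc'' = first" "s1 ''head'' = head" "s1 ''work'' 0 = 0"
      "s1 ''mark1'' = (\<lambda>_. 0)" "s1 ''roots1'' 0 = 0"
      using fr1 arrays init by simp_all
    have A: "set (stack (s1 ''roots0'')) = ?A" unfolding st1 by auto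
    have l1: "length (stack (s1 ''roots0'')) \<le> n"
      unfolding st1 by (rule order_trans[OF length_filter_le]) simp
    have d: "distinct [''roots0'', ''mark1'', ''roots1'', ''work'', ''arc'', ''node'', ''first_arc'', ''head'']"
      "distinct [''roots1'', ''mark2'', ''roots2'', ''work'', ''arc'', ''node'', ''first_arc'', ''head'']"
      by simp_all
    \<comment> \<open>The first pass has no order property to inherit, so its relation is trivially
      true.\<close>
    have src1: "set (stack (s1 ''roots0'')) \<subseteq> {..<n}"
      "sorted_wrt (\<lambda>_ _. True) (rev (stack (s1 ''roots0'')))"
      using A by (auto simp: sorted_wrt_iff_nth_less)
    show ?case
    proof (rule wp_mono[OF wp_find_roots[OF d(1) s1 src1]], goal_cases)
      case (1 t2 s2)
      define K1 where "K1 = stack (s2 ''roots1'')"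
      from 1 have fr2: "\<forall>x. x \<notin> {''roots0'', ''mark1'', ''roots1'', ''work'', ''arc'', ''node''} \<longrightarrow> s2 x = s1 x"
        and K1: "sorted_wrt (\<lambda>a b. (a, b) \<notin> arcs\<^sup>*) K1" "set K1 \<subseteq> ?A" "?A \<subseteq> arcs\<^sup>* `` set K1"
        and w2: "s2 ''work'' 0 = 0"
        and t2: "t2 \<le> b2 + 10 * length (stack (s1 ''roots0'')) + 1"
        unfolding A K1_def b2_def by blast+
      have s2: "s2 ''first_arc'' = first" "s2 ''head'' = head" "s2 ''work'' 0 = 0"
        "s2 ''mark2'' = (\<lambda>_. 0)" "s2 ''roots2'' 0 = 0"
        using fr1 fr2 w2 arrays init by simp_all
      \<comment> \<open>Reachability is reflexive, so the order property rules out repetitions; this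
        bounds the source of the second pass by \<open>n\<close>.\<close>
      have "distinct K1"
        using K1(1) unfolding sorted_wrt_iff_nth_less distinct_conv_nth
        by (metis linorder_neqE_nat rtrancl.rtrancl_refl)
      then have "length K1 = card (set K1)" by (simp add: distinct_card)
      also have "\<dots> \<le> card {..<n}" using K1(2) by (intro card_mono) auto
      finally have l2: "length (stack (s2 ''roots1'')) \<le> n" by (simp add: K1_def)
      \<comment> \<open>Popping reverses \<open>K1\<close>, which turns its order property into the
        opposite one. The second pass preserves that and adds the original direction, giving an
        antichain.\<close>
      have src2: "set (stack (s2 ''roots1'')) \<subseteq> {..<n}"
        "sorted_wrt (\<lambda>a b. (b, a) \<notin> arcs\<^sup>*) (rev (stack (s2 ''roots1'')))"
        using K1 by (auto simp: K1_def sorted_wrt_rev)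
      show ?case
      proof (rule wp_mono[OF wp_find_roots[OF d(2) s2 src2]], goal_cases)
        case (1 t3 s3)
        define K2 where "K2 = stack (s3 ''roots2'')"
        from 1 have fr3: "\<forall>x. x \<notin> {''roots1'', ''mark2'', ''roots2'', ''work'', ''arc'', ''node''} \<longrightarrow> s3 x = s2 x"
          and K2: "sorted_wrt (\<lambda>a b. (a, b) \<notin> arcs\<^sup>*) K2" "sorted_wrt (\<lambda>a b. (b, a) \<notin> arcs\<^sup>*) K2"
            "set K2 \<subseteq> set K1" "set K1 \<subseteq> arcs\<^sup>* `` set K2"
          and t3: "t3 \<le> b2 + 10 * length (stack (s2 ''roots1'')) + 1"
          unfolding K1_def K2_def b2_def by blast+
        have s3: "s3 ''escape'' = s1 ''escape''" "s3 ''budget'' = s ''budget''" "s3 ''result'' 0 = 0"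
          using fr1 fr2 fr3 init by simp_all
        have "?A \<subseteq> arcs\<^sup>* `` set K2"
        proof
          fix v assume "v \<in> ?A"
          then obtain a where "a \<in> set K1" "(a, v) \<in> arcs\<^sup>*" using K1(3) by blast
          moreover from this obtain b where "b \<in> set K2" "(b, a) \<in> arcs\<^sup>*" using K2(4) by blast
          ultimately show "v \<in> arcs\<^sup>* `` set K2" by (meson ImageI rtrancl_trans)
        qed
        moreover have "set K2 \<subseteq> ?A" using K1(2) K2(3) by blast
        \<comment> \<open>Two passes over at most \<open>n\<close> candidates at 10 units each add
          \<open>20 * n\<close>; the 2 is the final conditional with its branch.\<close>
        moreover have "t1 + (t2 + (t3 + 2)) \<le> 16 * first n + 37 * n + 5"
          using time t1 t2 t3 l1 l2 by linarith
        moreover have "length K2 = s3 ''roots2'' 0" by (simp add: K2_def)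
        ultimately show ?case
          unfolding closed_def[symmetric] using K2(1,2) es1 s3
          by (intro wp_If[THEN iffD2]) (auto intro!: exI[of _ K2] simp: not_less)
      qed
    qed
  qed
qed

end

section \<open>Instances in memory\<close>

text \<open>Splitting the concatenation around list \<open>i\<close> justifies storing the lists by
  offsets; the last two claims are the two directions of the correspondence.\<close>

lemma concat_segment:
  fixes xss :: "'b list list"
  defines "first i \<equiv> length (concat (take i xss))"
  assumes i: "i < length xss"
  shows "first (Suc i) = first i + length (xss ! i)"
    and "first i \<le> e \<Longrightarrow> e < first (Suc i) \<Longrightarrow> concat xss ! e \<in> set (xss ! i)"
    and "x \<in> set (xss ! i) \<Longrightarrow> \<exists>e. first i \<le> e \<and> e < first (Suc i) \<and> concat xss ! e = x"
proof -
  show Suc: "first (Suc i) = first i + length (xss ! i)"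
    unfolding first_def by (simp add: take_Suc_conv_app_nth[OF i])
  have split: "concat xss = concat (take i xss) @ xss ! i @ concat (drop (Suc i) xss)"
    using arg_cong[OF id_take_nth_drop[OF i], of concat] by simp
  have nth: "concat xss ! (first i + k) = xss ! i ! k" if "k < length (xss ! i)" for k
    unfolding first_def using that by (subst split) (simp add: nth_append)
  show "concat xss ! e \<in> set (xss ! i)" if "first i \<le> e" "e < first (Suc i)"
    using nth[of "e - first i"] that Suc by simp
  show "\<exists>e. first i \<le> e \<and> e < first (Suc i) \<and> concat xss ! e = x" if x: "x \<in> set (xss ! i)"
  proof -
    obtain k where "k < length (xss ! i)" "x = xss ! i ! k"
      using x by (auto simp: in_set_conv_nth)
    then show ?thesis using nth[of k] Suc by (intro exI[of _ "first i + k"]) simp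
  qed
qed

section \<open>Node numbers and the graph of the instance\<close>

locale stored_instance =
  fixes I :: "'a effectors_instance" and vs :: "'a list" and adj :: "(nat \<times> rat) list list"
  assumes I: "effectors_instance I" and adj: "adjacency_lists I vs adj"
begin

abbreviation "n \<equiv> length vs"
abbreviation "mem \<equiv> nat_input I vs adj"
abbreviation "first \<equiv> mem ''first_arc''"
abbreviation "arc_head \<equiv> mem ''head''"
abbreviation "D \<equiv> sure_arcs (graph I) (weight I)"

sublocale influence_graph "graph I" "weight I"
  using I by (simp add: effectors_instance_def)

lemma vs: "distinct vs" "set vs = pverts (graph I)" "length adj = n"
  using adj by (simp_all add: adjacency_lists_def)

lemma set_adj: "i < n \<Longrightarrow>
    set (adj ! i) = {(j, weight I (vs ! i, vs ! j)) | j. j < n \<and> (vs ! i, vs ! j) \<in> parcs (graph I)}"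
  using adj by (simp add: adjacency_lists_def)

lemma first_eq: "i \<le> n \<Longrightarrow> first i = length (concat (take i adj))"
  by (simp add: nat_input_def cells_def del: upt_Suc length_concat)

text \<open>Each list is distinct, and the weight is determined by the end points, so stored entries
  map injectively to arcs. This turns the time bound into one in \<open>graph_size\<close>.\<close>

lemma arcs_count: "first n \<le> card (parcs (graph I))"
proof -
  have "first n = length (concat adj)" using vs(3) by (simp add: first_eq)
  also have "\<dots> = (\<Sum>i<n. card (set (adj ! i)))"
  proof -
    have "length (adj ! i) = card (set (adj ! i))" if "i < n" for i
      using adj that by (metis adjacency_lists_def distinct_card)
    then show ?thesis using vs(3) by (simp add: length_concat sum_list_sum_nth lessThan_atLeast0)
  qed
  also have "\<dots> = card (SIGMA i:{..<n}. set (adj ! i))" by (simp add: card_SigmaI)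
  also have "\<dots> \<le> card (parcs (graph I))"
  proof (rule card_inj_on_le[OF _ _ pair_finite_arcs])
    let ?f = "\<lambda>(i, j, r :: rat). (vs ! i, vs ! j)"
    show "inj_on ?f (SIGMA i:{..<n}. set (adj ! i))"
    proof (rule inj_onI)
      fix x y
      assume xy: "x \<in> (SIGMA i:{..<n}. set (adj ! i))" "y \<in> (SIGMA i:{..<n}. set (adj ! i))"
        "?f x = ?f y"
      obtain i j r i' j' r' where [simp]: "x = (i, j, r)" "y = (i', j', r')" by (cases x, cases y)
      have less: "i < n" "i' < n" using xy(1,2) by simp_all
      then have "j < n" "j' < n" "r = weight I (vs ! i, vs ! j)" "r' = weight I (vs ! i', vs ! j')"
        using xy(1,2) by (simp_all add: set_adj)
      then show "x = y" using xy(3) less vs(1) by (simp add: nth_eq_iff_index_eq)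
    qed
    show "?f ` (SIGMA i:{..<n}. set (adj ! i)) \<subseteq> parcs (graph I)" by (auto simp: set_adj)
  qed
  finally show ?thesis .
qed

text \<open>Keeps arc numbers within the arrays, where \<open>cells\<close> returns stored entries
  and not its default 0.\<close>

lemma arc_number_less:
  assumes "i < n" "e < first (Suc i)"
  shows "e < length (concat adj)"
proof -
  have "concat adj = concat (take (Suc i) adj) @ concat (drop (Suc i) adj)"
    by (metis append_take_drop_id concat_append)
  then have "length (concat (take (Suc i) adj)) \<le> length (concat adj)" by (metis le_add1 length_append)
  then show ?thesis using assms first_eq[of "Suc i"] by simp
qed

lemma arc_number:
  assumes "i < n" "first i \<le> e" "e < first (Suc i)"
  obtains j where "arc_head e = j" "j < n" "(vs ! i, vs ! j) \<in> parcs (graph I)"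
    "rat_input I adj ''weight'' e = weight I (vs ! i, vs ! j)"
proof -
  have "concat adj ! e \<in> set (adj ! i)"
    using assms vs(3) by (intro concat_segment(2)) (simp_all add: first_eq)
  moreover note arc_number_less[OF assms(1,3)]
  ultimately show ?thesis
    using that set_adj[OF assms(1)] by (auto simp: nat_input_def rat_input_def cells_def)
qed

lemma arc_number_exists:
  assumes "i < n" "j < n" "(vs ! i, vs ! j) \<in> parcs (graph I)"
  obtains e where "first i \<le> e" "e < first (Suc i)" "arc_head e = j"
    "rat_input I adj ''weight'' e = weight I (vs ! i, vs ! j)"
proof -
  have "(j, weight I (vs ! i, vs ! j)) \<in> set (adj ! i)" using assms by (auto simp: set_adj)
  then obtain e where e: "first i \<le> e" "e < first (Suc i)"
    and c: "concat adj ! e = (j, weight I (vs ! i, vs ! j))"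
    using concat_segment(3)[of i adj] assms(1) vs(3) by (auto simp: first_eq)
  then show ?thesis
    using that[OF e] arc_number_less[OF assms(1) e(2)] by (simp add: nat_input_def rat_input_def cells_def)
qed

sublocale arc_arrays "rat_input I adj" first arc_head n
proof
  show "first u \<le> first (Suc u)" if "u < n" for u
    using that vs(3) concat_segment(1)[of u adj] by (simp add: first_eq)
  show "arc_head e < n" if "u < n" "e < first (Suc u)" for u e
    using that
  \<comment> \<open>The arc number may belong to a smaller node; the induction descends to the
    segment containing it and ends because \<open>first 0\<close> is 0.\<close>
  proof (induction u)
    case 0
    then show ?case using first_eq[of 0] arc_number[of 0 e] by auto
  next
    case (Suc u)
    then show ?case
    proof (cases "first (Suc u) \<le> e")
      case True
      from arc_number[OF Suc.prems(1) this Suc.prems(2)] show ?thesis by metis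
    qed (use Suc in simp)
  qed
qed

lemma arcs_iff: "(i, j) \<in> arcs \<longleftrightarrow> i < n \<and> j < n \<and> (vs ! i, vs ! j) \<in> D"
proof
  assume "(i, j) \<in> arcs"
  then obtain e where "i < n" "first i \<le> e" "e < first (Suc i)" "j = arc_head e"
    "1 \<le> rat_input I adj ''weight'' e" by (auto simp: arcs_def)
  then show "i < n \<and> j < n \<and> (vs ! i, vs ! j) \<in> D"
    by (auto simp: sure_arcs_def elim: arc_number)
next
  assume r: "i < n \<and> j < n \<and> (vs ! i, vs ! j) \<in> D"
  then obtain e where "first i \<le> e" "e < first (Suc i)" "arc_head e = j"
    "rat_input I adj ''weight'' e = weight I (vs ! i, vs ! j)"
    using arc_number_exists[of i j] by (auto simp: sure_arcs_def)
  then show "(i, j) \<in> arcs" using r by (auto simp: arcs_def sure_arcs_def)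
qed

text \<open>Arcs never leave the node set, so every path can be traced through node numbers;
  distinctness of \<open>vs\<close> makes the number of its end unique.\<close>

lemma arcs_rtrancl_iff:
  assumes "i < n" "j < n"
  shows "(i, j) \<in> arcs\<^sup>* \<longleftrightarrow> (vs ! i, vs ! j) \<in> D\<^sup>*"
proof
  assume "(i, j) \<in> arcs\<^sup>*"
  then show "(vs ! i, vs ! j) \<in> D\<^sup>*"
    by (induction rule: rtrancl_induct) (auto simp: arcs_iff intro: rtrancl.rtrancl_into_rtrancl)
next
  have "\<exists>j<n. y = vs ! j \<and> (i, j) \<in> arcs\<^sup>*" if "(vs ! i, y) \<in> D\<^sup>*" for y
    using that
  proof (induction rule: rtrancl_induct)
    case base
    then show ?case using assms(1) by blast
  next
    case (step y z)
    then obtain k where k: "k < n" "y = vs ! k" "(i, k) \<in> arcs\<^sup>*" by blast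
    have "z \<in> set vs" using step(2) in_arcsD2 vs(2) by (auto simp: sure_arcs_def)
    then obtain l where l: "l < n" "z = vs ! l" by (auto simp: in_set_conv_nth)
    then have "(k, l) \<in> arcs" using k step(2) by (simp add: arcs_iff)
    then have "(i, l) \<in> arcs\<^sup>*" using k(3) by (rule rtrancl.rtrancl_into_rtrancl[rotated])
    then show ?case using l by blast
  qed
  moreover assume "(vs ! i, vs ! j) \<in> D\<^sup>*"
  ultimately show "(i, j) \<in> arcs\<^sup>*" using vs(1) assms by (metis nth_eq_iff_index_eq)
qed

lemma target_iff: "i < n \<Longrightarrow> mem ''target'' i \<noteq> 0 \<longleftrightarrow> vs ! i \<in> targets I"
  by (simp add: nat_input_def cells_def)

lemma targets_eq: "targets I = (!) vs ` {i. i < n \<and> mem ''target'' i \<noteq> 0}"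
proof -
  have "targets I \<subseteq> set vs" using I vs(2) by (simp add: effectors_instance_def)
  then have "\<exists>i<n. x = vs ! i" if "x \<in> targets I" for x
    using that by (metis in_set_conv_nth subsetD)
  moreover have "{i. i < n \<and> mem ''target'' i \<noteq> 0} = {i. i < n \<and> vs ! i \<in> targets I}"
    using target_iff by blast
  ultimately show ?thesis by auto
qed

lemma targets_closed_iff:
  "(\<forall>u<n. mem ''target'' u \<noteq> 0 \<longrightarrow>
      (\<forall>e. first u \<le> e \<and> e < first (Suc u) \<longrightarrow> mem ''target'' (arc_head e) \<noteq> 0)) \<longleftrightarrow>
    parcs (graph I) `` targets I \<subseteq> targets I" (is "?l \<longleftrightarrow> ?r")
proof
  assume l: ?l
  show ?r
  proof
    fix y assume "y \<in> parcs (graph I) `` targets I"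
    then obtain x where x: "x \<in> targets I" "(x, y) \<in> parcs (graph I)" by blast
    then have "x \<in> set vs" "y \<in> set vs" using vs(2) wellformed' by blast+
    then obtain i j where ij: "i < n" "x = vs ! i" "j < n" "y = vs ! j"
      by (auto simp: in_set_conv_nth)
    then obtain e where "first i \<le> e" "e < first (Suc i)" "arc_head e = j"
      using arc_number_exists[of i j] x(2) by auto
    then have "mem ''target'' j \<noteq> 0" using l ij(1,2) x(1) target_iff[of i] by auto
    then show "y \<in> targets I" using ij target_iff by simp
  qed
next
  assume r: ?r
  show ?l
  proof (intro allI impI, elim conjE)
    fix u e assume u: "u < n" "mem ''target'' u \<noteq> 0" "first u \<le> e" "e < first (Suc u)"
    then obtain j where "arc_head e = j" "j < n" "(vs ! u, vs ! j) \<in> parcs (graph I)"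
      by (auto elim: arc_number)
    then show "mem ''target'' (arc_head e) \<noteq> 0" using r u target_iff by blast
  qed
qed

text \<open>Indexing into \<open>vs\<close> preserves and reflects reachability, so the antichain of
  numbers found by the program becomes an antichain of nodes covering the targets.\<close>

lemma effectors_iff:
  assumes cost: "cost I = 0"
    and K: "sorted_wrt (\<lambda>a b. (a, b) \<notin> arcs\<^sup>*) K" "sorted_wrt (\<lambda>a b. (b, a) \<notin> arcs\<^sup>*) K"
      "set K \<subseteq> {i. i < n \<and> mem ''target'' i \<noteq> 0}"
      "{i. i < n \<and> mem ''target'' i \<noteq> 0} \<subseteq> arcs\<^sup>* `` set K"
  shows "effectors I \<longleftrightarrow> parcs (graph I) `` targets I \<subseteq> targets I \<and> length K \<le> budget I"
proof -
  have less: "i < n" if "i \<in> set K" for i using that K(3) by blast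
  have "sorted_wrt (\<lambda>a b. (a, b) \<notin> D\<^sup>*) (map ((!) vs) K)"
    unfolding sorted_wrt_map using less by (auto intro: sorted_wrt_mono_rel[OF _ K(1)] simp: arcs_rtrancl_iff)
  moreover have "sorted_wrt (\<lambda>a b. (b, a) \<notin> D\<^sup>*) (map ((!) vs) K)"
    unfolding sorted_wrt_map using less by (auto intro: sorted_wrt_mono_rel[OF _ K(2)] simp: arcs_rtrancl_iff)
  moreover have "set (map ((!) vs) K) \<subseteq> targets I" using K(3) by (auto simp: targets_eq)
  moreover have "targets I \<subseteq> D\<^sup>* `` set (map ((!) vs) K)"
  proof
    fix x assume "x \<in> targets I"
    then obtain i where i: "i < n" "mem ''target'' i \<noteq> 0" "x = vs ! i" unfolding targets_eq by blast
    then obtain a where "a \<in> set K" "(a, i) \<in> arcs\<^sup>*" using K(4) by blast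
    then show "x \<in> D\<^sup>* `` set (map ((!) vs) K)" using i less arcs_rtrancl_iff[of a i] by auto
  qed
  ultimately show ?thesis using effectors_cost_0_iff[OF I cost, of "map ((!) vs) K"] by simp
qed

lemma exec_effectors_program:
  assumes cost: "cost I = 0"
  shows "\<exists>t s. exec (rat_input I adj) effectors_program mem t s \<and> t \<le> 37 * graph_size I + 5 \<and>
    s ''result'' 0 = (if effectors I then 1 else 0)"
proof -
  have nodes: "mem ''nodes'' 0 = n" "mem ''budget'' 0 = budget I"
    by (simp_all add: nat_input_def cells_def)
  have zero: "mem x = (\<lambda>_. 0)" if "x \<in> {''i'', ''escape'', ''work'', ''roots0'', ''roots1'',
      ''roots2'', ''mark1'', ''mark2'', ''result''}" for x
    using that by (auto simp: nat_input_def)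
  from wp_effectors_program[OF refl refl nodes(1) zero] obtain t s K
    where run: "exec (rat_input I adj) effectors_program mem t s"
      and K: "sorted_wrt (\<lambda>a b. (a, b) \<notin> arcs\<^sup>*) K" "sorted_wrt (\<lambda>a b. (b, a) \<notin> arcs\<^sup>*) K"
        "set K \<subseteq> {i. i < n \<and> mem ''target'' i \<noteq> 0}"
        "{i. i < n \<and> mem ''target'' i \<noteq> 0} \<subseteq> arcs\<^sup>* `` set K"
      and result: "s ''result'' 0 = (if parcs (graph I) `` targets I \<subseteq> targets I \<and>
        length K \<le> budget I then 1 else 0)"
      and t: "t \<le> 16 * first n + 37 * n + 5"
    unfolding wp_def targets_closed_iff nodes(2) by blast
  have "n = card (pverts (graph I))" using distinct_card[OF vs(1)] vs(2) by simp
  \<comment> \<open>The offset \<open>first n\<close> is at most the number of arcs, and 37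
    dominates the coefficient 16.\<close>
  then have "t \<le> 37 * graph_size I + 5" using t arcs_count by (simp add: graph_size_def)
  then show ?thesis using run result effectors_iff[OF cost K]
    by (intro exI[of _ t] exI[of _ s]) simp
qed

end

theorem lemma1:
  shows "solvable_in_linear_time
           {I :: 'a effectors_instance. effectors_instance I \<and> cost I = 0} effectors"
  unfolding solvable_in_linear_time_def
proof (rule exI[of _ effectors_program], rule exI[of _ "\<lambda>k. 37 * k + 5"],
    intro conjI ballI allI impI)
  \<comment> \<open>The factor 42 is 37 + 5, valid from size 1 on.\<close>
  show "(\<lambda>k. real (37 * k + 5)) \<in> O(\<lambda>k. real k)"
    by (rule bigoI[of _ 42]) (auto simp: eventually_sequentially intro!: exI[of _ 1])
next
  fix I :: "'a effectors_instance" and vs adj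
  assume "I \<in> {I. effectors_instance I \<and> cost I = 0}" "adjacency_lists I vs adj"
  then interpret stored_instance I vs adj by (simp add: stored_instance_def)
  show "\<exists>t s. exec (rat_input I adj) effectors_program (nat_input I vs adj) t s \<and>
      t \<le> 37 * graph_size I + 5 \<and> s ''result'' 0 = (if effectors I then 1 else 0)"
    using \<open>I \<in> _\<close> by (intro exec_effectors_program) simp
qed

end
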